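(* The set $\mathfrak{P}$ of bi-infinite Bratteli diagrams $\mathcal{B}\in\beth$ for which any surface $S(\mathcal{B},w^\pm,\leq_{r,s})$ (that is, for every choice of $w^\pm$ and $\leq_{r,s}$ making $(\mathcal{B},w^\pm,\leq_{r,s})$ a weighted, fully ordered bi-infinite Bratteli diagram) has completely periodic vertical and horizontal foliations is dense in $\beth$.
   Context: **Diagrams.** A Bratteli diagram $B=(V,E)$ is an infinite directed graph (multiple edges allowed) with $V=\bigsqcup_{k\ge 0}V_k$, $E=\bigsqcup_{k\ge1}E_k$, all $V_k,E_k$ finite and nonempty, and maps $r,s:E\to V$ with $r(E_k)=V_k$, $s(E_k)=V_{k-1}$. $X_B$ is the space of infinite paths $(e_1,e_2,\dots)$, $e_i\in E_i$, $r(e_i)=s(e_{i+1})$. Two paths are tail equivalent if they agree at all sufficiently large indices; a periodic component is a finite tail equivalence class. A bi-infinite Bratteli diagram $\mathcal{B}=(\mathcal{V},\mathcal{E})$ has $\mathcal{V}=\bigsqcup_{k\in\mathbb{Z}}\mathcal{V}_k$, $\mathcal{E}=\bigsqcup_{k\in\mathbb{Z}\setminus\{0\}}\mathcal{E}_k$ (finite nonempty levels) with $s(\mathcal{E}_k)=\mathcal{V}_{k-1}$, $r(\mathcal{E}_k)=\mathcal{V}_k$ for $k>0$ and $s(\mathcal{E}_k)=\mathcal{V}_k$, $r(\mathcal{E}_k)=\mathcal{V}_{k+1}$ for $k<0$. Its transition matrices $\mathcal{F}_k$, $k\ne0$, count the edges of $\mathcal{E}_k$ (rows indexed by ranges, columns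 by sources); they have no zero rows or columns. The positive part is the Bratteli diagram on levels $k\ge0$; the negative part is the Bratteli diagram with $V_k^-=\mathcal{V}_{-k}$, $E_k^-=\mathcal{E}_{-k}$ and the roles of $r,s$ exchanged. $\beth$ is the set of all bi-infinite Bratteli diagrams, identified with the composable sequences $(\dots,\mathcal{F}_{-2},\mathcal{F}_{-1},\mathcal{F}_1,\mathcal{F}_2,\dots)$ of non-negative integer matrices, with the topology generated by cylinder sets (finitely many matrices prescribed). **Orders and weights.** Orders $\leq_{r,s}$: $\leq_r$ totally orders each set $r^{-1}(v)$; $\leq_s$ totally orders each set $s^{-1}(v)$ and each vertex level. A weight function on $B$ is $w:V_0\cup E\to[0,\infty)$ such that: (i) $w(s(e_1))\prod_{i=1}^n w(e_i)=w(s(f_1))\prod_{i=1}^n w(f_i)$ for finite paths starting in $V_0$ with $r(e_n)=r(f_n)$; (ii) $\sum_{e\in s^{-1}(v)}w(e)=1$ for all $v\in V$; (iii) $\lim_n w(s(e_1))\prod_{i=1}^n w(e_i)=0$ for every $\bar e\in X_B$ not in a periodic component. It is a probability weight function if $\sum_{v\in V_0}w(v)=1$, finite if this sum is finite. For $v\in V_k$, put $w(v)=w(s(e_1))\prod_{i\le k} w(e_i)$ for any path from $V_0$ to $v$. A weighted bi-infinite diagram $(\mathcal{B},w^\pm)$ has a probability weight function $w^+$ on the positive part and a finite weight function $w^-$ on the negative part with $\sum_{v\in\mathcal{V}_0}w^-(v)w^+(v)=1$. **The surface $S(\mathcal{B},w^\pm,\leq_{r,s})$.** Define $T^+$ on $[0,1]$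 by cutting and stacking. At stage $0$, $[0,1]$ is divided into consecutive intervals of length $w^+(v)$, $v\in\mathcal{V}_0$, in the order $\leq_s$ on $\mathcal{V}_0$; each is a tower with one level. Given at stage $k$ a tower for each $v\in\mathcal{V}_k$ all of whose levels are intervals of length $w^+(v)$, cut it vertically into subtowers, one for each $e\in s^{-1}(v)$, of width $w^+(v)w^+(e)$, from left to right in the order $\leq_s$; the stage $k+1$ tower of $v'\in\mathcal{V}_{k+1}$ is obtained by stacking the subtowers indexed by $e\in r^{-1}(v')$ from bottom to top in the order $\leq_r$. $T_k$ translates the interior of each non-top level of a stage-$k$ tower onto the interior of the level directly above; $T_{k+1}$ extends $T_k$, and $T^+=\lim_k T_k$; on a periodic component of positive weight, the top interval of the limiting tower is translated to the bottom one (this reflects the convention that in a periodic component the successor of the maximal path is the minimal path). $T^-$ on $[0,b^-]$, $b^-=\sum_{v\in\mathcal{V}_0}w^-(v)$, is defined in the same way from the negative part and $w^-$, with the roles of $\leq_r$ and $\leq_s$ on negative levels exchanged and the initial intervals placed in the order on $\mathcal{V}_0$. With $\mathcal{V}_0=\{v_1,v_2,\dots\}$ in its order, let $$R_i=\Big[\sum_{j<i}w^+(v_j),\sum_{j\le i}w^+(v_j)\Big]\times\Big[\sum_{j<i}w^-(v_j),\sum_{j\le i}w^-(v_j)\Big].$$ Let $\Sigma\subset\bigcup_i\partial R_i$ be the points corresponding to discontinuities of $T^+$ or $T^-$. Then $S(\mathcal{B},w^\pm,\leq_{r,s})=(\bigcup_iR_i\setminus\Sigma)/\sim$, where a point $(x,y)$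 on a top edge is identified with the point $(T^+(x),y')$ on the bottom edge of the rectangle over $T^+(x)$, and a point $(x,y)$ on a right edge is identified with the point $(x',T^-(y))$ on the left edge of the rectangle at height $T^-(y)$. This is a flat (translation) surface of area $1$. The vertical (resp. horizontal) foliation is the foliation by vertical (resp. horizontal) straight lines. It is completely periodic if almost every point returns to itself after finite time under the unit-speed flow along the foliation, so that the surface decomposes into cylinders of closed leaves. *)

theory Defs
  imports "HOL-Analysis.Analysis" "Jordan_Normal_Form.Matrix"
begin

section \<open>One-sided Bratteli diagrams\<close>

text \<open>The edge level \<open>E\<^sub>k\<close> is meaningful for \<open>k \<ge> 1\<close> only.\<close>

record ('v, 'e) bratteli =
  verts :: "nat \<Rightarrow> 'v set"
  edges :: "nat \<Rightarrow> 'e set"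
  rng :: "'e \<Rightarrow> 'v"
  src :: "'e \<Rightarrow> 'v"

definition bratteli_diagram :: "('v, 'e) bratteli \<Rightarrow> bool" where
  "bratteli_diagram B \<longleftrightarrow>
     (\<forall>k. finite (verts B k) \<and> verts B k \<noteq> {}) \<and>
     (\<forall>k\<ge>1. finite (edges B k) \<and> edges B k \<noteq> {}) \<and>
     (\<forall>k l. k \<noteq> l \<longrightarrow> verts B k \<inter> verts B l = {}) \<and>
     (\<forall>k\<ge>1. \<forall>l\<ge>1. k \<noteq> l \<longrightarrow> edges B k \<inter> edges B l = {}) \<and>
     (\<forall>k\<ge>1. rng B ` edges B k = verts B k \<and> src B ` edges B k = verts B (k - 1))"

definition all_edges :: "('v, 'e) bratteli \<Rightarrow> 'e set" where
  "all_edges B = (\<Union>k\<in>{1..}. edges B k)"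

definition rng_fibre :: "('v, 'e) bratteli \<Rightarrow> 'v \<Rightarrow> 'e set" where
  "rng_fibre B v = {e \<in> all_edges B. rng B e = v}"

definition src_fibre :: "('v, 'e) bratteli \<Rightarrow> 'v \<Rightarrow> 'e set" where
  "src_fibre B v = {e \<in> all_edges B. src B e = v}"

text \<open>The path \<open>(e\<^sub>1, e\<^sub>2, \<dots>)\<close> is the sequence \<open>x\<close> with \<open>x i = e\<^bsub>i+1\<^esub>\<close>; likewise for the
  (nonempty) finite paths starting in \<open>V\<^sub>0\<close>, which are lists.\<close>

definition infinite_paths :: "('v, 'e) bratteli \<Rightarrow> (nat \<Rightarrow> 'e) set" where
  "infinite_paths B =
     {x. \<forall>i. x i \<in> edges B (Suc i) \<and> rng B (x i) = src B (x (Suc i))}"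

definition finite_paths :: "('v, 'e) bratteli \<Rightarrow> 'e list set" where
  "finite_paths B =
     {es. es \<noteq> [] \<and> (\<forall>i<length es. es ! i \<in> edges B (Suc i)) \<and>
          (\<forall>i. Suc i < length es \<longrightarrow> rng B (es ! i) = src B (es ! Suc i))}"

definition tail_class :: "('v, 'e) bratteli \<Rightarrow> (nat \<Rightarrow> 'e) \<Rightarrow> (nat \<Rightarrow> 'e) set" where
  "tail_class B x = {y \<in> infinite_paths B. \<forall>\<^sub>F i in sequentially. x i = y i}"

definition in_periodic_component :: "('v, 'e) bratteli \<Rightarrow> (nat \<Rightarrow> 'e) \<Rightarrow> bool" where
  "in_periodic_component B x \<longleftrightarrow> x \<in> infinite_paths B \<and> finite (tail_class B x)"


section \<open>Weight functions\<close>

record ('v, 'e) weight =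
  vwt :: "'v \<Rightarrow> real"
  ewt :: "'e \<Rightarrow> real"

definition path_weight ::
    "('v, 'e) bratteli \<Rightarrow> ('v, 'e) weight \<Rightarrow> 'e list \<Rightarrow> real" where
  "path_weight B w es = vwt w (src B (hd es)) * (\<Prod>e\<leftarrow>es. ewt w e)"

definition weight_function :: "('v, 'e) bratteli \<Rightarrow> ('v, 'e) weight \<Rightarrow> bool" where
  "weight_function B w \<longleftrightarrow>
     (\<forall>v\<in>verts B 0. 0 \<le> vwt w v) \<and>
     (\<forall>e\<in>all_edges B. 0 \<le> ewt w e) \<and>
     (\<forall>es\<in>finite_paths B. \<forall>fs\<in>finite_paths B.
        length es = length fs \<and> rng B (last es) = rng B (last fs) \<longrightarrow>
        path_weight B w es = path_weight B w fs) \<and>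
     (\<forall>k. \<forall>v\<in>verts B k. (\<Sum>e\<in>src_fibre B v. ewt w e) = 1) \<and>
     (\<forall>x\<in>infinite_paths B. \<not> in_periodic_component B x \<longrightarrow>
        (\<lambda>n. path_weight B w (map x [0..<Suc n])) \<longlonglongrightarrow> 0)"

definition probability_weight_function ::
    "('v, 'e) bratteli \<Rightarrow> ('v, 'e) weight \<Rightarrow> bool" where
  "probability_weight_function B w \<longleftrightarrow>
     weight_function B w \<and> (\<Sum>v\<in>verts B 0. vwt w v) = 1"

text \<open>The weight \<open>w(v)\<close> of a vertex \<open>v \<in> V\<^sub>k\<close>; for a weight function it does not depend on the
  choice of the path.\<close>

definition vertex_weight ::
    "('v, 'e) bratteli \<Rightarrow> ('v, 'e) weight \<Rightarrow> nat \<Rightarrow> 'v \<Rightarrow> real" where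
  "vertex_weight B w k v =
     (if k = 0 then vwt w v
      else path_weight B w
             (SOME es. es \<in> finite_paths B \<and> length es = k \<and> rng B (last es) = v))"


section \<open>Cutting and stacking\<close>

text \<open>Orders are reflexive relations: \<open>(x, y) \<in> R\<close> means that \<open>x\<close> is at most \<open>y\<close>.\<close>

definition totally_orders :: "'a rel \<Rightarrow> 'a set \<Rightarrow> bool" where
  "totally_orders R A \<longleftrightarrow> linear_order_on A (Restr R A)"

definition below :: "'a rel \<Rightarrow> 'a set \<Rightarrow> 'a \<Rightarrow> 'a set" where
  "below R A a = {b \<in> A. (b, a) \<in> R \<and> b \<noteq> a}"

definition enumerate_by :: "'a rel \<Rightarrow> 'a set \<Rightarrow> 'a list" where
  "enumerate_by R A =
     (THE xs. set xs = A \<and> distinct xs \<and> sorted_wrt (\<lambda>a b. (a, b) \<in> R) xs)"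

definition initial_pos ::
    "('v, 'e) bratteli \<Rightarrow> ('v, 'e) weight \<Rightarrow> 'v rel \<Rightarrow> 'v \<Rightarrow> real" where
  "initial_pos B w Ov v = (\<Sum>u\<in>below Ov (verts B 0) v. vwt w u)"

text \<open>\<open>tower B w Ov Oc Os k v\<close> lists, from bottom to top, the left endpoints of the levels of the
  stage-\<open>k\<close> tower of \<open>v\<close>; all its levels are intervals of length \<open>w(v)\<close>. The initial intervals
  are placed by \<open>Ov\<close>, towers are cut by \<open>Oc\<close> (on source fibres) and stacked by \<open>Os\<close> (on range
  fibres).\<close>

primrec tower ::
    "('v, 'e) bratteli \<Rightarrow> ('v, 'e) weight \<Rightarrow> 'v rel \<Rightarrow> 'e rel \<Rightarrow> 'e rel \<Rightarrow> nat \<Rightarrow> 'v \<Rightarrow> real list"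
  where
    "tower B w Ov Oc Os 0 v = [initial_pos B w Ov v]"
  | "tower B w Ov Oc Os (Suc k) v =
       concat (map (\<lambda>e. map (\<lambda>a. a + vertex_weight B w k (src B e) *
                                     (\<Sum>f\<in>below Oc (src_fibre B (src B e)) e. ewt w f))
                            (tower B w Ov Oc Os k (src B e)))
                   (enumerate_by Os (rng_fibre B v)))"

text \<open>Partially defined maps of the line are represented by their graphs.\<close>

definition stage_map ::
    "('v, 'e) bratteli \<Rightarrow> ('v, 'e) weight \<Rightarrow> 'v rel \<Rightarrow> 'e rel \<Rightarrow> 'e rel \<Rightarrow> nat \<Rightarrow> real rel" where
  "stage_map B w Ov Oc Os k =
     {(x, y). \<exists>v\<in>verts B k. \<exists>i. Suc i < length (tower B w Ov Oc Os k v) \<and>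
        tower B w Ov Oc Os k v ! i < x \<and>
        x < tower B w Ov Oc Os k v ! i + vertex_weight B w k v \<and>
        y = tower B w Ov Oc Os k v ! Suc i + (x - tower B w Ov Oc Os k v ! i)}"

text \<open>Along a path \<open>p\<close> of a periodic component the towers of the vertices \<open>src B (p k)\<close> eventually
  have constant height and nested levels, so the limiting tower has the limits of the left
  endpoints and of the widths as its left endpoints and width. If the limiting width is \<open>0\<close>, the
  component contributes nothing.\<close>

definition periodic_map ::
    "('v, 'e) bratteli \<Rightarrow> ('v, 'e) weight \<Rightarrow> 'v rel \<Rightarrow> 'e rel \<Rightarrow> 'e rel \<Rightarrow> real rel" where
  "periodic_map B w Ov Oc Os =
     {(x, y). \<exists>p. in_periodic_component B p \<and>
        (let top = lim (\<lambda>k. last (tower B w Ov Oc Os k (src B (p k))));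
             bot = lim (\<lambda>k. hd (tower B w Ov Oc Os k (src B (p k))));
             width = lim (\<lambda>k. vertex_weight B w k (src B (p k)))
         in top < x \<and> x < top + width \<and> y = bot + (x - top))}"

definition cut_stack_map ::
    "('v, 'e) bratteli \<Rightarrow> ('v, 'e) weight \<Rightarrow> 'v rel \<Rightarrow> 'e rel \<Rightarrow> 'e rel \<Rightarrow> real rel" where
  "cut_stack_map B w Ov Oc Os =
     (\<Union>k. stage_map B w Ov Oc Os k) \<union> periodic_map B w Ov Oc Os"


section \<open>Bi-infinite Bratteli diagrams\<close>

text \<open>The edge level \<open>E\<^sub>k\<close> is meaningful for \<open>k \<noteq> 0\<close> only.\<close>

record ('v, 'e) bi_bratteli =
  bverts :: "int \<Rightarrow> 'v set"
  bedges :: "int \<Rightarrow> 'e set"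
  brng :: "'e \<Rightarrow> 'v"
  bsrc :: "'e \<Rightarrow> 'v"

definition bi_bratteli_diagram :: "('v, 'e) bi_bratteli \<Rightarrow> bool" where
  "bi_bratteli_diagram D \<longleftrightarrow>
     (\<forall>k. finite (bverts D k) \<and> bverts D k \<noteq> {}) \<and>
     (\<forall>k. k \<noteq> 0 \<longrightarrow> finite (bedges D k) \<and> bedges D k \<noteq> {}) \<and>
     (\<forall>k l. k \<noteq> l \<longrightarrow> bverts D k \<inter> bverts D l = {}) \<and>
     (\<forall>k l. k \<noteq> 0 \<and> l \<noteq> 0 \<and> k \<noteq> l \<longrightarrow> bedges D k \<inter> bedges D l = {}) \<and>
     (\<forall>k>0. bsrc D ` bedges D k = bverts D (k - 1) \<and> brng D ` bedges D k = bverts D k) \<and>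
     (\<forall>k<0. bsrc D ` bedges D k = bverts D k \<and> brng D ` bedges D k = bverts D (k + 1))"

definition positive_part :: "('v, 'e) bi_bratteli \<Rightarrow> ('v, 'e) bratteli" where
  "positive_part D =
     \<lparr>verts = (\<lambda>k. bverts D (int k)), edges = (\<lambda>k. bedges D (int k)),
      rng = brng D, src = bsrc D\<rparr>"

definition negative_part :: "('v, 'e) bi_bratteli \<Rightarrow> ('v, 'e) bratteli" where
  "negative_part D =
     \<lparr>verts = (\<lambda>k. bverts D (- int k)), edges = (\<lambda>k. bedges D (- int k)),
      rng = bsrc D, src = brng D\<rparr>"

lemma bratteli_diagram_positive_part:
  assumes "bi_bratteli_diagram D"
  shows "bratteli_diagram (positive_part D)"
  using assms unfolding bi_bratteli_diagram_def bratteli_diagram_def positive_part_def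
  by (auto simp: of_nat_diff)

lemma bratteli_diagram_negative_part:
  assumes "bi_bratteli_diagram D"
  shows "bratteli_diagram (negative_part D)"
  using assms unfolding bi_bratteli_diagram_def bratteli_diagram_def negative_part_def
  by (auto simp: of_nat_diff)

text \<open>Of \<open>ord_r\<close>, \<open>ord_s\<close> and \<open>ord_v\<close> only the restrictions to fibres of the range map, fibres of
  the source map and vertex levels matter.\<close>

record ('v, 'e) bi_orders =
  ord_r :: "'e rel"
  ord_s :: "'e rel"
  ord_v :: "'v rel"

definition fully_ordered ::
    "('v, 'e) bi_bratteli \<Rightarrow> ('v, 'e) bi_orders \<Rightarrow> bool" where
  "fully_ordered D Q \<longleftrightarrow>
     (\<forall>k. \<forall>v\<in>bverts D k.
        totally_orders (ord_r Q) {e \<in> (\<Union>l\<in>{l. l \<noteq> 0}. bedges D l). brng D e = v} \<and>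
        totally_orders (ord_s Q) {e \<in> (\<Union>l\<in>{l. l \<noteq> 0}. bedges D l). bsrc D e = v}) \<and>
     (\<forall>k. totally_orders (ord_v Q) (bverts D k))"

text \<open>Finiteness of the weight function on the negative part is automatic, as \<open>V\<^sub>0\<close> is finite.\<close>

definition weighted ::
    "('v, 'e) bi_bratteli \<Rightarrow> ('v, 'e) weight \<Rightarrow> ('v, 'e) weight \<Rightarrow> bool" where
  "weighted D wp wm \<longleftrightarrow>
     probability_weight_function (positive_part D) wp \<and>
     weight_function (negative_part D) wm \<and>
     (\<Sum>v\<in>bverts D 0. vwt wm v * vwt wp v) = 1"


section \<open>Gluing rectangles\<close>

text \<open>A family of rectangles \<open>[xl v, xr v] \<times> [yb v, yt v]\<close> together with the graphs of the partial
  maps used to glue top edges to bottom edges (\<open>up_map\<close>, acting on the first coordinate) and right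
  edges to left edges (\<open>right_map\<close>, acting on the second coordinate).\<close>

record 'v rectangles =
  idx :: "'v set"
  xl :: "'v \<Rightarrow> real"
  xr :: "'v \<Rightarrow> real"
  yb :: "'v \<Rightarrow> real"
  yt :: "'v \<Rightarrow> real"
  up_map :: "real rel"
  right_map :: "real rel"

definition rect :: "'v rectangles \<Rightarrow> 'v \<Rightarrow> (real \<times> real) set" where
  "rect G v = {xl G v..xr G v} \<times> {yb G v..yt G v}"

definition top_edge :: "'v rectangles \<Rightarrow> 'v \<Rightarrow> (real \<times> real) set" where
  "top_edge G v = {xl G v..xr G v} \<times> {yt G v}"

definition bottom_edge :: "'v rectangles \<Rightarrow> 'v \<Rightarrow> (real \<times> real) set" where
  "bottom_edge G v = {xl G v..xr G v} \<times> {yb G v}"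

definition left_edge :: "'v rectangles \<Rightarrow> 'v \<Rightarrow> (real \<times> real) set" where
  "left_edge G v = {xl G v} \<times> {yb G v..yt G v}"

definition right_edge :: "'v rectangles \<Rightarrow> 'v \<Rightarrow> (real \<times> real) set" where
  "right_edge G v = {xr G v} \<times> {yb G v..yt G v}"

text \<open>The gluing maps are translations on open intervals and are not defined elsewhere, so a
  discontinuity of a map or of its inverse is a point where it is undefined. All corners are
  removed.\<close>

definition singular_points :: "'v rectangles \<Rightarrow> (real \<times> real) set" where
  "singular_points G = (\<Union>v\<in>idx G.
     {p \<in> top_edge G v. fst p \<notin> Domain (up_map G)} \<union>
     {p \<in> bottom_edge G v. fst p \<notin> Range (up_map G)} \<union>
     {p \<in> right_edge G v. snd p \<notin> Domain (right_map G)} \<union>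
     {p \<in> left_edge G v. snd p \<notin> Range (right_map G)})"

definition regular_points :: "'v rectangles \<Rightarrow> (real \<times> real) set" where
  "regular_points G = (\<Union>v\<in>idx G. rect G v) - singular_points G"

definition gluing :: "'v rectangles \<Rightarrow> (real \<times> real) rel" where
  "gluing G =
     {(p, q). \<exists>u\<in>idx G. \<exists>v\<in>idx G.
        p \<in> top_edge G u \<and> q \<in> bottom_edge G v \<and> (fst p, fst q) \<in> up_map G} \<union>
     {(p, q). \<exists>u\<in>idx G. \<exists>v\<in>idx G.
        p \<in> right_edge G u \<and> q \<in> left_edge G v \<and> (snd p, snd q) \<in> right_map G}"

text \<open>The equivalence relation on the regular points that is generated by the gluing.\<close>

definition surface_equiv :: "'v rectangles \<Rightarrow> (real \<times> real) rel" where
  "surface_equiv G =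
     (let R = Restr (gluing G) (regular_points G)
      in Restr ((R \<union> R\<inverse>)\<^sup>*) (regular_points G))"

lemma equiv_surface_equiv: "equiv (regular_points G) (surface_equiv G)"
proof -
  define R where "R = Restr (gluing G) (regular_points G)"
  have "sym ((R \<union> R\<inverse>)\<^sup>*)"
    by (intro sym_rtrancl sym_Un_converse)
  then show ?thesis
    unfolding surface_equiv_def Let_def R_def[symmetric]
    by (auto simp: equiv_def refl_on_def sym_def trans_def)
qed

definition surface :: "'v rectangles \<Rightarrow> (real \<times> real) set set" where
  "surface G = regular_points G // surface_equiv G"

definition surface_point :: "'v rectangles \<Rightarrow> real \<times> real \<Rightarrow> (real \<times> real) set" where
  "surface_point G p = surface_equiv G `` {p}"


section \<open>Linear flows on the surface\<close>

text \<open>A trajectory \<open>\<gamma>\<close> on \<open>[0, L]\<close> of the flow in direction \<open>d\<close> is locally, on either side of each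
  time, the image of a straight segment traversed with velocity \<open>d\<close>. The forward and the backward
  segment at a time may start from different representatives of the same point of the surface: this
  is how a trajectory passes through a glued edge.\<close>

definition flow_trajectory ::
    "'v rectangles \<Rightarrow> real \<times> real \<Rightarrow> real \<Rightarrow> (real \<Rightarrow> (real \<times> real) set) \<Rightarrow> bool" where
  "flow_trajectory G d L \<gamma> \<longleftrightarrow>
     (\<forall>t\<in>{0..L}. \<gamma> t \<in> surface G) \<and>
     (\<forall>t\<in>{0..<L}. \<exists>p. \<exists>\<epsilon>>0. \<forall>\<tau>\<in>{0..<\<epsilon>}.
        p + \<tau> *\<^sub>R d \<in> regular_points G \<and> \<gamma> (t + \<tau>) = surface_point G (p + \<tau> *\<^sub>R d)) \<and>
     (\<forall>t\<in>{0<..L}. \<exists>p. \<exists>\<epsilon>>0. \<forall>\<tau>\<in>{0..<\<epsilon>}.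
        p - \<tau> *\<^sub>R d \<in> regular_points G \<and> \<gamma> (t - \<tau>) = surface_point G (p - \<tau> *\<^sub>R d))"

definition returns_to_itself ::
    "'v rectangles \<Rightarrow> real \<times> real \<Rightarrow> (real \<times> real) set \<Rightarrow> bool" where
  "returns_to_itself G d s \<longleftrightarrow>
     (\<exists>L>0. \<exists>\<gamma>. flow_trajectory G d L \<gamma> \<and> \<gamma> 0 = s \<and> \<gamma> L = s)"

text \<open>The area measure of the surface is Lebesgue measure on the rectangles.\<close>

definition completely_periodic :: "'v rectangles \<Rightarrow> real \<times> real \<Rightarrow> bool" where
  "completely_periodic G d \<longleftrightarrow>
     (AE p in lebesgue. p \<in> regular_points G \<longrightarrow> returns_to_itself G d (surface_point G p))"

abbreviation "vertical_direction \<equiv> (0, 1) :: real \<times> real"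
abbreviation "horizontal_direction \<equiv> (1, 0) :: real \<times> real"


section \<open>The surface of a weighted, fully ordered bi-infinite diagram\<close>

text \<open>On the positive part, \<open>ord_s\<close> cuts and \<open>ord_r\<close> stacks. The negative part has the roles of
  range and source exchanged, so there \<open>ord_r\<close> cuts and \<open>ord_s\<close> stacks.\<close>

definition rectangles_of ::
    "('v, 'e) bi_bratteli \<Rightarrow> ('v, 'e) weight \<Rightarrow> ('v, 'e) weight \<Rightarrow> ('v, 'e) bi_orders \<Rightarrow>
     'v rectangles" where
  "rectangles_of D wp wm Q =
     \<lparr>idx = bverts D 0,
      xl = initial_pos (positive_part D) wp (ord_v Q),
      xr = (\<lambda>v. initial_pos (positive_part D) wp (ord_v Q) v + vwt wp v),
      yb = initial_pos (negative_part D) wm (ord_v Q),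
      yt = (\<lambda>v. initial_pos (negative_part D) wm (ord_v Q) v + vwt wm v),
      up_map = cut_stack_map (positive_part D) wp (ord_v Q) (ord_s Q) (ord_r Q),
      right_map = cut_stack_map (negative_part D) wm (ord_v Q) (ord_r Q) (ord_s Q)\<rparr>"


section \<open>The space of bi-infinite Bratteli diagrams\<close>

text \<open>A bi-infinite diagram is identified with the sequence of its transition matrices
  \<open>F\<^sub>k\<close>, \<open>k \<noteq> 0\<close> (rows indexed by ranges, columns by sources). Since \<open>s(E\<^sub>1) = V\<^sub>0 = r(E\<^bsub>-1\<^esub>)\<close>,
  the columns of \<open>F\<^sub>1\<close> and the rows of \<open>F\<^bsub>-1\<^esub>\<close> are both indexed by \<open>V\<^sub>0\<close>.\<close>

definition beth :: "(int \<Rightarrow> nat mat) set" where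
  "beth = {F \<in> extensional {k. k \<noteq> 0}.
     (\<forall>k. k \<noteq> 0 \<longrightarrow>
        dim_row (F k) > 0 \<and> dim_col (F k) > 0 \<and>
        (\<forall>i<dim_row (F k). \<exists>j<dim_col (F k). F k $$ (i, j) \<noteq> 0) \<and>
        (\<forall>j<dim_col (F k). \<exists>i<dim_row (F k). F k $$ (i, j) \<noteq> 0)) \<and>
     (\<forall>k>0. dim_col (F (k + 1)) = dim_row (F k)) \<and>
     dim_col (F 1) = dim_row (F (- 1)) \<and>
     (\<forall>k<0. dim_col (F k) = dim_row (F (k - 1)))}"

text \<open>The vertices of level \<open>k\<close> are the pairs \<open>(k, j)\<close>; the quadruple \<open>(k, i, j, m)\<close> is the
  \<open>m\<close>-th edge of level \<open>k\<close> whose range has index \<open>i\<close> and whose source has index \<open>j\<close>.\<close>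

definition diagram_of :: "(int \<Rightarrow> nat mat) \<Rightarrow> (int \<times> nat, int \<times> nat \<times> nat \<times> nat) bi_bratteli"
  where
  "diagram_of F =
     \<lparr>bverts = (\<lambda>k. {k} \<times> {..<dim_col (F (if k \<ge> 0 then k + 1 else k))}),
      bedges = (\<lambda>k. {(l, i, j, m). l = k \<and> i < dim_row (F k) \<and> j < dim_col (F k) \<and>
                                    m < F k $$ (i, j)}),
      brng = (\<lambda>(k, i, j, m). (if k > 0 then k else k + 1, i)),
      bsrc = (\<lambda>(k, i, j, m). (if k > 0 then k - 1 else k, j))\<rparr>"

definition cylinder :: "int set \<Rightarrow> (int \<Rightarrow> nat mat) \<Rightarrow> (int \<Rightarrow> nat mat) set" where
  "cylinder K F = {G \<in> beth. \<forall>k\<in>K. G k = F k}"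

definition beth_topology :: "(int \<Rightarrow> nat mat) topology" where
  "beth_topology = topology_generated_by {cylinder K F | K F. finite K \<and> 0 \<notin> K}"

definition periodic_diagrams :: "(int \<Rightarrow> nat mat) set" where
  "periodic_diagrams = {F \<in> beth. \<forall>wp wm Q.
     weighted (diagram_of F) wp wm \<and> fully_ordered (diagram_of F) Q \<longrightarrow>
     completely_periodic (rectangles_of (diagram_of F) wp wm Q) vertical_direction \<and>
     completely_periodic (rectangles_of (diagram_of F) wp wm Q) horizontal_direction}"

lemma topspace_beth_topology: "topspace beth_topology = beth"
proof -
  have "cylinder {} F = beth" for F
    by (auto simp: cylinder_def)
  then have "beth \<in> {cylinder K F | K F. finite K \<and> 0 \<notin> K}"
    by (smt (verit) empty_iff finite.emptyI mem_Collect_eq)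
  then show ?thesis
    unfolding beth_topology_def topology_generated_by_topspace
    by (auto simp: cylinder_def)
qed

lemma bi_bratteli_diagram_diagram_of:
  assumes "F \<in> beth"
  shows "bi_bratteli_diagram (diagram_of F)"
proof -
  have pos: "dim_row (F k) > 0" "dim_col (F k) > 0" if "k \<noteq> 0" for k
    using assms that by (auto simp: beth_def)
  have rows: "\<exists>j<dim_col (F k). F k $$ (i, j) \<noteq> 0" if "k \<noteq> 0" "i < dim_row (F k)" for k i
    using assms that by (auto simp: beth_def)
  have cols: "\<exists>i<dim_row (F k). F k $$ (i, j) \<noteq> 0" if "k \<noteq> 0" "j < dim_col (F k)" for k j
    using assms that by (auto simp: beth_def)
  have comp: "dim_col (F (k + 1)) = dim_row (F k)" if "k > 0" for k
    using assms that by (auto simp: beth_def)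
  have comp0: "dim_col (F 1) = dim_row (F (- 1))"
    using assms by (auto simp: beth_def)
  have compn: "dim_col (F k) = dim_row (F (k - 1))" if "k < 0" for k
    using assms that by (auto simp: beth_def)
  have verts_succ: "bverts (diagram_of F) (if k > 0 then k else k + 1) =
      {if k > 0 then k else k + 1} \<times> {..<dim_row (F k)}" if nz: "k \<noteq> 0" for k
  proof -
    consider "k > 0" | "k = - 1" | "k < - 1" using nz by linarith
    then show ?thesis
      by cases (use comp[of k] comp0 compn[of "k + 1"] in \<open>auto simp: diagram_of_def\<close>)
  qed
  have verts_pred: "bverts (diagram_of F) (if k > 0 then k - 1 else k) =
      {if k > 0 then k - 1 else k} \<times> {..<dim_col (F k)}" if "k \<noteq> 0" for k
    using that by (auto simp: diagram_of_def)
  have rng: "brng (diagram_of F) ` bedges (diagram_of F) k =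
      {if k > 0 then k else k + 1} \<times> {..<dim_row (F k)}" if nz: "k \<noteq> 0" for k
  proof (intro equalityI subsetI)
    fix v assume "v \<in> {if k > 0 then k else k + 1} \<times> {..<dim_row (F k)}"
    then obtain i where i: "v = (if k > 0 then k else k + 1, i)" "i < dim_row (F k)" by auto
    obtain j where "j < dim_col (F k)" "F k $$ (i, j) \<noteq> 0" using rows[OF nz i(2)] by blast
    then have "(k, i, j, 0) \<in> bedges (diagram_of F) k" "brng (diagram_of F) (k, i, j, 0) = v"
      using i by (auto simp: diagram_of_def)
    then show "v \<in> brng (diagram_of F) ` bedges (diagram_of F) k" by force
  qed (auto simp: diagram_of_def)
  have src: "bsrc (diagram_of F) ` bedges (diagram_of F) k =
      {if k > 0 then k - 1 else k} \<times> {..<dim_col (F k)}" if nz: "k \<noteq> 0" for k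
  proof (intro equalityI subsetI)
    fix v assume "v \<in> {if k > 0 then k - 1 else k} \<times> {..<dim_col (F k)}"
    then obtain j where j: "v = (if k > 0 then k - 1 else k, j)" "j < dim_col (F k)" by auto
    obtain i where "i < dim_row (F k)" "F k $$ (i, j) \<noteq> 0" using cols[OF nz j(2)] by blast
    then have "(k, i, j, 0) \<in> bedges (diagram_of F) k" "bsrc (diagram_of F) (k, i, j, 0) = v"
      using j by (auto simp: diagram_of_def)
    then show "v \<in> bsrc (diagram_of F) ` bedges (diagram_of F) k" by force
  qed (auto simp: diagram_of_def)
  have "finite (bedges (diagram_of F) k)" for k
  proof -
    have "bedges (diagram_of F) k =
        (\<Union>i<dim_row (F k). \<Union>j<dim_col (F k). (\<lambda>m. (k, i, j, m)) ` {..<F k $$ (i, j)})"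
      by (auto simp: diagram_of_def)
    then show ?thesis by simp
  qed
  moreover have "bedges (diagram_of F) k \<noteq> {}" if "k \<noteq> 0" for k
    using rng[OF that] pos[OF that] by auto
  moreover have "finite (bverts (diagram_of F) k) \<and> bverts (diagram_of F) k \<noteq> {}" for k
    using pos[of k] pos[of "k + 1"] by (auto simp: diagram_of_def)
  moreover have "bverts (diagram_of F) k \<inter> bverts (diagram_of F) l = {}"
      "bedges (diagram_of F) k \<inter> bedges (diagram_of F) l = {}" if "k \<noteq> l" for k l
    using that by (auto simp: diagram_of_def)
  moreover have "bsrc (diagram_of F) ` bedges (diagram_of F) k = bverts (diagram_of F) (k - 1)"
      "brng (diagram_of F) ` bedges (diagram_of F) k = bverts (diagram_of F) k" if "k > 0" for k
    using rng[of k] src[of k] verts_succ[of k] verts_pred[of k] that by simp_all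
  moreover have "bsrc (diagram_of F) ` bedges (diagram_of F) k = bverts (diagram_of F) k"
      "brng (diagram_of F) ` bedges (diagram_of F) k = bverts (diagram_of F) (k + 1)" if "k < 0" for k
    using rng[of k] src[of k] verts_succ[of k] verts_pred[of k] that by simp_all
  ultimately show ?thesis
    unfolding bi_bratteli_diagram_def by simp
qed

lemma transition_matrix_diagram_of:
  assumes "k \<noteq> 0" "i < dim_row (F k)" "j < dim_col (F k)"
  shows "card {e \<in> bedges (diagram_of F) k.
           snd (brng (diagram_of F) e) = i \<and> snd (bsrc (diagram_of F) e) = j} = F k $$ (i, j)"
proof -
  have "{e \<in> bedges (diagram_of F) k.
          snd (brng (diagram_of F) e) = i \<and> snd (bsrc (diagram_of F) e) = j}
        = (\<lambda>m. (k, i, j, m)) ` {..<F k $$ (i, j)}"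
    using assms by (auto simp: diagram_of_def)
  then show ?thesis
    by (simp add: card_image inj_on_def)
qed

end

theory Submission
  imports Defs
begin

text \<open>
  A cylinder set constrains only finitely many transition matrices, so a given diagram may be changed
  freely at all levels beyond some \<open>n\<close>. Replacing the matrices at those levels by identity matrices
  (\<open>truncate_by_identity\<close>) keeps the sequence composable and gives a diagram in the same cylinder.
  Density follows once such a diagram is known to have only completely periodic surfaces,
  whatever the weights and orders (\<open>eventually_identity_completely_periodic\<close>).

  An identity matrix neither cuts nor stacks: each vertex has one outgoing edge, which must have
  weight \<open>1\<close>, and one incoming edge. Hence the towers no longer change after stage \<open>n\<close>
  (\<open>stable_tower\<close>). Moreover every infinite path lies in a periodic component, because a path tail
  equivalent to it can differ from it in the first \<open>n\<close> edges only (\<open>all_paths_periodic\<close>). So on the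
  tower of each vertex at stage \<open>n\<close>, the cutting and stacking map moves every level to the next one
  and the top level back to the bottom one: it permutes the levels of the tower cyclically. As these
  levels fill the interval up to finitely many points, all but finitely many points are periodic
  (\<open>almost_all_points_periodic\<close>).

  A vertical leaf follows the orbit of its first coordinate under \<open>T\<^sup>+\<close>, crossing one rectangle for each
  step, so it closes up when that orbit does (\<open>vertical_return\<close>). The points over finitely many abscissae
  and those on horizontal edges of rectangles are left out; they form a null set. The
  horizontal foliation behaves in the same way with \<open>T\<^sup>-\<close>.
\<close>

section \<open>Finite totally ordered sets\<close>

lemma totally_orders_iff:
  "totally_orders R A \<longleftrightarrow>
     (\<forall>a\<in>A. \<forall>b\<in>A. (a, b) \<in> R \<or> (b, a) \<in> R) \<and>
     (\<forall>a\<in>A. \<forall>b\<in>A. (a, b) \<in> R \<and> (b, a) \<in> R \<longrightarrow> a = b) \<and>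
     (\<forall>a\<in>A. \<forall>b\<in>A. \<forall>c\<in>A. (a, b) \<in> R \<and> (b, c) \<in> R \<longrightarrow> (a, c) \<in> R)"
proof -
  have "refl_on A (Restr R A) \<and> total_on A (Restr R A) \<longleftrightarrow>
      (\<forall>a\<in>A. \<forall>b\<in>A. (a, b) \<in> R \<or> (b, a) \<in> R)"
    unfolding refl_on_def total_on_def by auto metis
  moreover have "antisym (Restr R A) \<longleftrightarrow>
      (\<forall>a\<in>A. \<forall>b\<in>A. (a, b) \<in> R \<and> (b, a) \<in> R \<longrightarrow> a = b)"
    unfolding antisym_def by auto
  moreover have "trans (Restr R A) \<longleftrightarrow>
      (\<forall>a\<in>A. \<forall>b\<in>A. \<forall>c\<in>A. (a, b) \<in> R \<and> (b, c) \<in> R \<longrightarrow> (a, c) \<in> R)"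
    unfolding trans_def by auto
  moreover have "Restr R A \<subseteq> A \<times> A" by auto
  ultimately show ?thesis
    unfolding totally_orders_def order_on_defs by argo
qed

lemma totally_orders_subset:
  "totally_orders R A \<Longrightarrow> B \<subseteq> A \<Longrightarrow> totally_orders R B"
  unfolding totally_orders_iff subset_iff by (elim conjE, intro conjI) blast+

lemma totally_orders_total:
  "totally_orders R A \<Longrightarrow> a \<in> A \<Longrightarrow> b \<in> A \<Longrightarrow> (a, b) \<in> R \<or> (b, a) \<in> R"
  unfolding totally_orders_iff by blast

lemma totally_orders_antisym:
  "totally_orders R A \<Longrightarrow> a \<in> A \<Longrightarrow> b \<in> A \<Longrightarrow> (a, b) \<in> R \<Longrightarrow> (b, a) \<in> R \<Longrightarrow> a = b"
  unfolding totally_orders_iff by blast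

lemma totally_orders_trans:
  "totally_orders R A \<Longrightarrow> a \<in> A \<Longrightarrow> b \<in> A \<Longrightarrow> c \<in> A \<Longrightarrow>
    (a, b) \<in> R \<Longrightarrow> (b, c) \<in> R \<Longrightarrow> (a, c) \<in> R"
  unfolding totally_orders_iff by blast

lemma sorted_enumeration_exists:
  assumes "finite A" "totally_orders R A"
  shows "\<exists>xs. set xs = A \<and> distinct xs \<and> sorted_wrt (\<lambda>a b. (a, b) \<in> R) xs"
  using assms
proof (induction A rule: finite_induct)
  case empty
  then show ?case by simp
next
  case (insert a A)
  then obtain xs where xs: "set xs = A" "distinct xs" "sorted_wrt (\<lambda>a b. (a, b) \<in> R) xs"
    using totally_orders_subset[OF insert.prems] by blast
  have above: "(a, c) \<in> R" if "c \<in> A" "(c, a) \<notin> R" for c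
    using totally_orders_total[OF insert.prems, of a c] that by auto
  have across: "(b, c) \<in> R" if "b \<in> A" "c \<in> A" "(b, a) \<in> R" "(c, a) \<notin> R" for b c
    using totally_orders_trans[OF insert.prems, of b a c] above[of c] that by auto
  let ?ys = "filter (\<lambda>b. (b, a) \<in> R) xs @ a # filter (\<lambda>b. (b, a) \<notin> R) xs"
  have "set ?ys = insert a A" using xs(1) by auto
  moreover have "distinct ?ys" using xs insert.hyps by auto
  moreover have "sorted_wrt (\<lambda>a b. (a, b) \<in> R) ?ys"
    using xs above across by (auto simp: sorted_wrt_append intro: sorted_wrt_filter)
  ultimately show ?case by blast
qed

text \<open>By antisymmetry two sorted enumerations have the same first element.\<close>

lemma sorted_enumeration_unique:
  assumes "totally_orders R A"
    and "set xs \<subseteq> A" "distinct xs" "sorted_wrt (\<lambda>a b. (a, b) \<in> R) xs"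
    and "set ys = set xs" "distinct ys" "sorted_wrt (\<lambda>a b. (a, b) \<in> R) ys"
  shows "ys = xs"
  using assms(2-)
proof (induction xs arbitrary: ys)
  case Nil
  then show ?case by simp
next
  case (Cons x xs)
  then obtain y zs where ys: "ys = y # zs" by (cases ys) auto
  have "y = x"
  proof (rule ccontr)
    assume "y \<noteq> x"
    then have "x \<in> set zs" "y \<in> set xs" using Cons.prems ys by auto
    then have "(y, x) \<in> R" "(x, y) \<in> R" using Cons.prems ys by auto
    moreover have "x \<in> A" "y \<in> A" using Cons.prems(1) \<open>y \<in> set xs\<close> by auto
    ultimately show False
      using totally_orders_antisym[OF assms(1)] \<open>y \<noteq> x\<close> by blast
  qed
  moreover from this have "set zs = set xs" using Cons.prems ys by auto
  ultimately show ?case using Cons ys by auto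
qed

lemma enumerate_by:
  assumes "finite A" "totally_orders R A"
  shows "set (enumerate_by R A) = A" "distinct (enumerate_by R A)"
    "sorted_wrt (\<lambda>a b. (a, b) \<in> R) (enumerate_by R A)"
proof -
  obtain xs where xs: "set xs = A \<and> distinct xs \<and> sorted_wrt (\<lambda>a b. (a, b) \<in> R) xs"
    using sorted_enumeration_exists[OF assms] by blast
  have "\<exists>!xs. set xs = A \<and> distinct xs \<and> sorted_wrt (\<lambda>a b. (a, b) \<in> R) xs"
  proof (rule ex1I)
    fix ys assume "set ys = A \<and> distinct ys \<and> sorted_wrt (\<lambda>a b. (a, b) \<in> R) ys"
    then show "ys = xs" using xs sorted_enumeration_unique[OF assms(2), of xs ys] by simp
  qed (rule xs)
  from theI'[OF this] show "set (enumerate_by R A) = A" "distinct (enumerate_by R A)"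
    "sorted_wrt (\<lambda>a b. (a, b) \<in> R) (enumerate_by R A)"
    unfolding enumerate_by_def by auto
qed

lemma enumerate_by_singleton: "totally_orders R {a} \<Longrightarrow> enumerate_by R {a} = [a]"
  using enumerate_by(1,2)[of "{a}" R]
  by (cases "enumerate_by R {a}") (auto simp: subset_singleton_iff)

lemma below_enumerate_by:
  assumes "finite A" "totally_orders R A" "i < length (enumerate_by R A)"
  shows "below R A (enumerate_by R A ! i) = set (take i (enumerate_by R A))"
proof -
  define xs where "xs = enumerate_by R A"
  have xs: "set xs = A" "distinct xs" "sorted_wrt (\<lambda>a b. (a, b) \<in> R) xs" "i < length xs"
    using enumerate_by[OF assms(1,2)] assms(3) by (auto simp: xs_def)
  have less: "(xs ! m, xs ! n) \<in> R" if "m < n" "n < length xs" for m n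
    using xs(3) that by (simp add: sorted_wrt_iff_nth_less)
  have nth_below: "xs ! j \<in> below R A (xs ! i) \<longleftrightarrow> j < i" if j: "j < length xs" for j
  proof -
    have in_A: "xs ! i \<in> A" "xs ! j \<in> A" using xs j by auto
    have ne: "xs ! j \<noteq> xs ! i" if "j \<noteq> i" using xs j that by (simp add: nth_eq_iff_index_eq)
    consider "j < i" | "j = i" | "i < j" by linarith
    then show ?thesis
    proof cases
      case 1
      then have "(xs ! j, xs ! i) \<in> R" "xs ! j \<noteq> xs ! i" using less[of j i] xs(4) ne by auto
      then show ?thesis using 1 in_A by (simp add: below_def)
    next
      case 2
      then show ?thesis by (simp add: below_def)
    next
      case 3
      then have "(xs ! i, xs ! j) \<in> R" "xs ! j \<noteq> xs ! i" using less[of i j] j ne by auto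
      then have "(xs ! j, xs ! i) \<notin> R"
        using totally_orders_antisym[OF assms(2) in_A] by auto
      then show ?thesis using 3 by (simp add: below_def)
    qed
  qed
  have "b \<in> below R A (xs ! i) \<longleftrightarrow> (\<exists>j<i. b = xs ! j)" for b
  proof
    assume b: "b \<in> below R A (xs ! i)"
    then have "b \<in> set xs" using xs(1) by (simp add: below_def)
    then obtain j where "j < length xs" "b = xs ! j" unfolding in_set_conv_nth by blast
    then show "\<exists>j<i. b = xs ! j" using nth_below[of j] b by (intro exI[of _ j]) simp
  next
    assume "\<exists>j<i. b = xs ! j"
    then obtain j where "j < i" "b = xs ! j" by blast
    then show "b \<in> below R A (xs ! i)" using nth_below[of j] xs(4) by simp
  qed
  moreover have "set (take i xs) = (!) xs ` {0..<i}"
    using nth_image[of i xs] xs(4) by simp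
  then have "b \<in> set (take i xs) \<longleftrightarrow> (\<exists>j<i. b = xs ! j)" for b
    by auto
  ultimately have "below R A (xs ! i) = set (take i xs)" by blast
  then show ?thesis by (simp add: xs_def)
qed

text \<open>Stacking intervals of lengths \<open>g e\<close> in the order \<open>R\<close> tiles an interval of length \<open>sum g A\<close>. The
  piece containing \<open>x\<close> ends at the first partial sum that exceeds \<open>x\<close>.\<close>

lemma point_in_some_piece:
  fixes g :: "'a \<Rightarrow> real"
  assumes "finite A" "totally_orders R A"
    and "l < x" "x < l + sum g A"
    and ends: "\<And>e. e \<in> A \<Longrightarrow> x \<noteq> l + sum g (below R A e)"
  shows "\<exists>e\<in>A. l + sum g (below R A e) < x \<and> x < l + sum g (below R A e) + g e"
proof -
  define xs where "xs = enumerate_by R A"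
  have xs: "set xs = A" "distinct xs"
    using enumerate_by[OF assms(1,2)] by (auto simp: xs_def)
  define s where "s i = l + sum g (set (take i xs))" for i
  have "x < s (length xs)" using assms(4) xs by (simp add: s_def)
  then obtain i where i: "x < s i" "\<And>j. j < i \<Longrightarrow> \<not> x < s j"
    using exists_least_iff[of "\<lambda>i. x < s i"] by auto
  have "i \<noteq> 0"
  proof
    assume "i = 0"
    then show False using i(1) assms(3) by (simp add: s_def)
  qed
  then obtain j where j: "i = Suc j" by (cases i) auto
  have len: "j < length xs"
  proof (rule ccontr)
    assume "\<not> j < length xs"
    then have "s j = s i" by (simp add: s_def j)
    then show False using i(1) i(2)[of j] j by simp
  qed
  have below: "l + sum g (below R A (xs ! j)) = s j"
    using below_enumerate_by[OF assms(1,2)] len by (simp add: xs_def s_def)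
  have "xs ! j \<notin> set (take j xs)"
    using xs(2) len by (auto simp: in_set_conv_nth nth_eq_iff_index_eq)
  then have "s i = s j + g (xs ! j)"
    using len by (simp add: s_def j take_Suc_conv_app_nth)
  moreover have "xs ! j \<in> A" using len xs by auto
  ultimately show ?thesis
    using i(1) i(2)[of j] ends[of "xs ! j"] below j by (intro bexI[of _ "xs ! j"]) auto
qed


section \<open>Towers of a weighted ordered diagram\<close>

text \<open>The positive and the negative part of a bi-infinite diagram are treated alike: \<open>Oc\<close> is the order by
  which towers are cut and \<open>Os\<close> the one by which they are stacked.\<close>

locale ordered_weighted_diagram =
  fixes B :: "('v, 'e) bratteli" and w :: "('v, 'e) weight"
    and Ov :: "'v rel" and Oc Os :: "'e rel"
  assumes diagram: "bratteli_diagram B"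
    and weight: "weight_function B w"
    and cut_order: "v \<in> verts B k \<Longrightarrow> totally_orders Oc (src_fibre B v)"
    and stack_order: "v \<in> verts B k \<Longrightarrow> totally_orders Os (rng_fibre B v)"
begin

abbreviation width :: "nat \<Rightarrow> 'v \<Rightarrow> real" where
  "width \<equiv> vertex_weight B w"

abbreviation levels :: "nat \<Rightarrow> 'v \<Rightarrow> real list" where
  "levels \<equiv> tower B w Ov Oc Os"

abbreviation T :: "real rel" where
  "T \<equiv> cut_stack_map B w Ov Oc Os"

abbreviation base :: "'v \<Rightarrow> real set" where
  "base u \<equiv> {initial_pos B w Ov u <..< initial_pos B w Ov u + vwt w u}"

text \<open>Position of the left end of the subtower of \<open>e\<close> in its tower, as a fraction of the tower's width.\<close>

definition cut_offset :: "'e \<Rightarrow> real" where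
  "cut_offset e = (\<Sum>f\<in>below Oc (src_fibre B (src B e)) e. ewt w f)"

lemma finite_verts: "finite (verts B k)"
  and finite_edges: "finite (edges B (Suc k))"
  and rng_edge: "e \<in> edges B (Suc k) \<Longrightarrow> rng B e \<in> verts B (Suc k)"
  and src_edge: "e \<in> edges B (Suc k) \<Longrightarrow> src B e \<in> verts B k"
  using diagram unfolding bratteli_diagram_def by (auto dest!: spec[of _ "Suc k"])

lemma verts_eq_level: "v \<in> verts B k \<Longrightarrow> v \<in> verts B l \<Longrightarrow> k = l"
  using diagram unfolding bratteli_diagram_def by blast

lemma in_edge_exists:
  assumes "v \<in> verts B (Suc k)"
  shows "\<exists>e\<in>edges B (Suc k). rng B e = v"
proof -
  have "rng B ` edges B (Suc k) = verts B (Suc k)"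
    using diagram unfolding bratteli_diagram_def by simp
  then have "v \<in> rng B ` edges B (Suc k)" using assms by simp
  then show ?thesis by blast
qed

lemma out_edge_exists:
  assumes "v \<in> verts B k"
  shows "\<exists>e\<in>edges B (Suc k). src B e = v"
proof -
  have "\<forall>k\<ge>1. src B ` edges B k = verts B (k - 1)"
    using diagram unfolding bratteli_diagram_def by simp
  from this[rule_format, of "Suc k"] have "v \<in> src B ` edges B (Suc k)" using assms by simp
  then show ?thesis by blast
qed

lemma all_edges_Suc: "e \<in> all_edges B \<longleftrightarrow> (\<exists>k. e \<in> edges B (Suc k))"
proof
  assume "e \<in> all_edges B"
  then obtain k where "1 \<le> k" "e \<in> edges B k" unfolding all_edges_def by auto
  then show "\<exists>k. e \<in> edges B (Suc k)" by (intro exI[of _ "k - 1"]) simp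
qed (auto simp: all_edges_def)

lemma rng_fibre_level:
  "v \<in> verts B (Suc k) \<Longrightarrow> rng_fibre B v = {e \<in> edges B (Suc k). rng B e = v}"
  unfolding rng_fibre_def all_edges_Suc using rng_edge verts_eq_level by blast

lemma src_fibre_level:
  "v \<in> verts B k \<Longrightarrow> src_fibre B v = {e \<in> edges B (Suc k). src B e = v}"
  unfolding src_fibre_def all_edges_Suc using src_edge verts_eq_level by blast

lemma finite_src_fibre: "v \<in> verts B k \<Longrightarrow> finite (src_fibre B v)"
  by (simp add: src_fibre_level finite_edges)

lemma set_enumerate_rng_fibre:
  assumes "v \<in> verts B (Suc k)"
  shows "set (enumerate_by Os (rng_fibre B v)) = {e \<in> edges B (Suc k). rng B e = v}"
proof -
  have "finite (rng_fibre B v)" using assms finite_edges[of k] by (simp add: rng_fibre_level)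
  from enumerate_by(1)[OF this stack_order[OF assms]] show ?thesis
    using rng_fibre_level[OF assms] by simp
qed

lemma ewt_nonneg:
  assumes "e \<in> edges B (Suc k)"
  shows "0 \<le> ewt w e"
proof -
  have "\<forall>e\<in>all_edges B. 0 \<le> ewt w e" using weight unfolding weight_function_def by blast
  then show ?thesis using all_edges_Suc assms by blast
qed

lemma sum_ewt_src_fibre: "v \<in> verts B k \<Longrightarrow> (\<Sum>e\<in>src_fibre B v. ewt w e) = 1"
  using weight unfolding weight_function_def by blast

lemma finite_path_snoc:
  assumes "es \<in> finite_paths B" "length es = k" "e \<in> edges B (Suc k)" "src B e = rng B (last es)"
  shows "es @ [e] \<in> finite_paths B"
proof -
  have es: "es \<noteq> []" "\<And>i. i < k \<Longrightarrow> es ! i \<in> edges B (Suc i)"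
    "\<And>i. Suc i < k \<Longrightarrow> rng B (es ! i) = src B (es ! Suc i)"
    using assms(1,2) by (auto simp: finite_paths_def)
  have "(es @ [e]) ! i \<in> edges B (Suc i)" if "i < Suc k" for i
    using that es(2) assms(2,3) by (cases "i = k") (auto simp: nth_append)
  moreover have "rng B ((es @ [e]) ! i) = src B ((es @ [e]) ! Suc i)" if "Suc i < Suc k" for i
  proof (cases "Suc i = k")
    case True
    then have "last es = es ! i" using assms(2) es(1) by (auto simp: last_conv_nth)
    then show ?thesis using True assms(2,4) by (simp add: nth_append)
  next
    case False
    then show ?thesis using that es(3)[of i] assms(2) by (simp add: nth_append)
  qed
  ultimately show ?thesis using assms(2) by (simp add: finite_paths_def)
qed

lemma finite_path_to:
  "v \<in> verts B (Suc k) \<Longrightarrow> \<exists>es\<in>finite_paths B. length es = Suc k \<and> rng B (last es) = v"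
proof (induction k arbitrary: v)
  case 0
  then obtain e where "e \<in> edges B (Suc 0)" "rng B e = v" using in_edge_exists by blast
  then show ?case by (intro bexI[of _ "[e]"]) (auto simp: finite_paths_def)
next
  case (Suc k)
  then obtain e where e: "e \<in> edges B (Suc (Suc k))" "rng B e = v" using in_edge_exists by blast
  obtain es where "es \<in> finite_paths B" "length es = Suc k" "rng B (last es) = src B e"
    using Suc.IH src_edge[OF e(1)] by blast
  then show ?case using finite_path_snoc[of es "Suc k" e] e by (intro bexI[of _ "es @ [e]"]) auto
qed

lemma path_weight_eq:
  assumes "es \<in> finite_paths B" "fs \<in> finite_paths B"
    and "length es = length fs" "rng B (last es) = rng B (last fs)"
  shows "path_weight B w es = path_weight B w fs"
proof -
  have "\<forall>es\<in>finite_paths B. \<forall>fs\<in>finite_paths B.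
      length es = length fs \<and> rng B (last es) = rng B (last fs) \<longrightarrow>
      path_weight B w es = path_weight B w fs"
    using weight unfolding weight_function_def by (elim conjE)
  then show ?thesis using assms by blast
qed

lemma width_path:
  assumes "es \<in> finite_paths B" "length es = Suc k" "rng B (last es) = v"
  shows "width (Suc k) v = path_weight B w es"
proof -
  define fs where "fs = (SOME es. es \<in> finite_paths B \<and> length es = Suc k \<and> rng B (last es) = v)"
  have "fs \<in> finite_paths B \<and> length fs = Suc k \<and> rng B (last fs) = v"
    unfolding fs_def by (rule someI[of _ es]) (use assms in auto)
  then have "path_weight B w fs = path_weight B w es"
    using path_weight_eq[of fs es] assms by simp
  then show ?thesis by (simp add: vertex_weight_def fs_def)
qed

text \<open>The weight of a vertex may be computed along any path to it, in particular along one that ends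
  with the edge \<open>e\<close>.\<close>

lemma width_Suc:
  assumes "e \<in> edges B (Suc k)"
  shows "width (Suc k) (rng B e) = width k (src B e) * ewt w e"
proof (cases k)
  case 0
  then have "[e] \<in> finite_paths B" using assms by (simp add: finite_paths_def)
  from width_path[OF this, of k] 0 show ?thesis by (simp add: path_weight_def vertex_weight_def)
next
  case (Suc m)
  then obtain es where es: "es \<in> finite_paths B" "length es = k" "rng B (last es) = src B e"
    using finite_path_to src_edge[OF assms] by blast
  have "width (Suc k) (rng B e) = path_weight B w (es @ [e])"
    using width_path[OF finite_path_snoc[OF es(1,2) assms]] es by simp
  moreover have "es \<noteq> []" using es(1) by (auto simp: finite_paths_def)
  then have "path_weight B w (es @ [e]) = path_weight B w es * ewt w e"
    by (simp add: path_weight_def)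
  ultimately show ?thesis using width_path[OF es(1)] es Suc by simp
qed

lemma width_nonneg: "v \<in> verts B k \<Longrightarrow> 0 \<le> width k v"
proof (induction k arbitrary: v)
  case 0
  then show ?case using weight by (simp add: vertex_weight_def weight_function_def)
next
  case (Suc k)
  then obtain e where "e \<in> edges B (Suc k)" "rng B e = v" using in_edge_exists by blast
  then show ?case using width_Suc Suc.IH[OF src_edge] ewt_nonneg by force
qed

lemma set_levels_Suc:
  assumes "v \<in> verts B (Suc k)"
  shows "set (levels (Suc k) v) =
    {a + width k (src B e) * cut_offset e | a e.
       e \<in> edges B (Suc k) \<and> rng B e = v \<and> a \<in> set (levels k (src B e))}"
  using set_enumerate_rng_fibre[OF assms] by (auto simp: cut_offset_def)

lemma levels_nonempty: "v \<in> verts B k \<Longrightarrow> levels k v \<noteq> []"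
proof (induction k arbitrary: v)
  case (Suc k)
  obtain e where e: "e \<in> edges B (Suc k)" "rng B e = v" using in_edge_exists[OF Suc.prems] by blast
  obtain a where "a \<in> set (levels k (src B e))"
    using Suc.IH[OF src_edge[OF e(1)]] by (cases "levels k (src B e)") auto
  then have "set (levels (Suc k) v) \<noteq> {}"
    unfolding set_levels_Suc[OF Suc.prems] using e by blast
  then show ?case by auto
qed simp

lemma cut_offset_bounds:
  assumes "e \<in> edges B (Suc k)"
  shows "0 \<le> cut_offset e" "cut_offset e + ewt w e \<le> 1"
proof -
  let ?A = "src_fibre B (src B e)"
  have A: "?A = {f \<in> edges B (Suc k). src B f = src B e}" and fin: "finite ?A"
    using src_fibre_level finite_src_fibre src_edge[OF assms] by auto
  have nonneg: "0 \<le> ewt w f" if "f \<in> ?A" for f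
    using that A ewt_nonneg by auto
  have "below Oc ?A e \<subseteq> ?A" by (auto simp: below_def)
  then show "0 \<le> cut_offset e"
    unfolding cut_offset_def by (intro sum_nonneg) (use nonneg in auto)
  have "cut_offset e + ewt w e = (\<Sum>f\<in>insert e (below Oc ?A e). ewt w f)"
    using finite_subset[OF \<open>below Oc ?A e \<subseteq> ?A\<close> fin]
    by (subst sum.insert) (auto simp: cut_offset_def below_def)
  also have "\<dots> \<le> (\<Sum>f\<in>?A. ewt w f)"
    using fin assms A nonneg by (intro sum_mono2) (auto simp: below_def)
  finally show "cut_offset e + ewt w e \<le> 1"
    using sum_ewt_src_fibre src_edge[OF assms] by simp
qed

text \<open>Cutting only shrinks levels, so every level stays inside one of the initial intervals and hence
  below a single rectangle.\<close>

lemma levels_in_base: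
  assumes "v \<in> verts B k" "a \<in> set (levels k v)"
  shows "\<exists>u\<in>verts B 0. {a<..<a + width k v} \<subseteq> base u"
  using assms
proof (induction k arbitrary: v a)
  case 0
  then show ?case by (auto simp: vertex_weight_def intro!: bexI[of _ v])
next
  case (Suc k)
  obtain e b where e: "e \<in> edges B (Suc k)" "rng B e = v" and b: "b \<in> set (levels k (src B e))"
    and a: "a = b + width k (src B e) * cut_offset e"
    using Suc.prems unfolding set_levels_Suc[OF Suc.prems(1)] by blast
  have W: "0 \<le> width k (src B e)" using width_nonneg src_edge e by blast
  have "width k (src B e) * (cut_offset e + ewt w e) \<le> width k (src B e)"
    using mult_left_mono[OF cut_offset_bounds(2)[OF e(1)] W] by simp
  moreover have "0 \<le> width k (src B e) * cut_offset e"
    using W cut_offset_bounds(1)[OF e(1)] by simp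
  moreover have "width (Suc k) v = width k (src B e) * ewt w e" using width_Suc e by blast
  ultimately have "{a<..<a + width (Suc k) v} \<subseteq> {b<..<b + width k (src B e)}"
    using a by (auto simp: algebra_simps)
  then show ?case using Suc.IH[OF src_edge[OF e(1)] b] by blast
qed

text \<open>Each cut loses only the finitely many points at which the levels are divided.\<close>

lemma almost_all_points_in_levels:
  "\<exists>Z. finite Z \<and> (\<forall>u\<in>verts B 0. \<forall>x\<in>base u - Z.
     \<exists>v\<in>verts B k. \<exists>a\<in>set (levels k v). a < x \<and> x < a + width k v)"
proof (induction k)
  case 0
  show ?case by (intro exI[of _ "{}"]) (auto simp: vertex_weight_def)
next
  case (Suc k)
  then obtain Z where Z: "finite Z" "\<And>u x. u \<in> verts B 0 \<Longrightarrow> x \<in> base u \<Longrightarrow> x \<notin> Z \<Longrightarrow>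
     \<exists>v\<in>verts B k. \<exists>a\<in>set (levels k v). a < x \<and> x < a + width k v"
    by blast
  define Z' where "Z' = Z \<union> (\<Union>v\<in>verts B k. \<Union>a\<in>set (levels k v). \<Union>e\<in>src_fibre B v.
     {a + width k v * cut_offset e})"
  have "finite Z'" unfolding Z'_def using Z(1) finite_verts finite_src_fibre by auto
  moreover have "\<exists>v\<in>verts B (Suc k). \<exists>a\<in>set (levels (Suc k) v). a < x \<and> x < a + width (Suc k) v"
    if ux: "u \<in> verts B 0" "x \<in> base u" "x \<notin> Z'" for u x
  proof -
    obtain v a where v: "v \<in> verts B k" and a: "a \<in> set (levels k v)" "a < x" "x < a + width k v"
      using Z(2)[OF ux(1,2)] ux(3) by (auto simp: Z'_def)
    define g where "g f = width k v * ewt w f" for f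
    have offset: "sum g (below Oc (src_fibre B v) e) = width k v * cut_offset e"
      if "e \<in> src_fibre B v" for e
      using that by (simp add: g_def cut_offset_def sum_distrib_left src_fibre_def)
    have "sum g (src_fibre B v) = width k v"
      using sum_ewt_src_fibre[OF v] by (simp add: g_def flip: sum_distrib_left)
    moreover have "x \<noteq> a + sum g (below Oc (src_fibre B v) e)" if "e \<in> src_fibre B v" for e
    proof -
      have "a + width k v * cut_offset e \<in> Z'"
        unfolding Z'_def using v a(1) that by (intro UnI2 UN_I) auto
      then show ?thesis using ux(3) offset[OF that] by auto
    qed
    ultimately have "\<exists>e\<in>src_fibre B v. a + sum g (below Oc (src_fibre B v) e) < x \<and>
        x < a + sum g (below Oc (src_fibre B v) e) + g e"
      using a by (intro point_in_some_piece[OF finite_src_fibre[OF v] cut_order[OF v]]) auto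
    then obtain e where e: "e \<in> src_fibre B v" "a + width k v * cut_offset e < x"
      "x < a + width k v * cut_offset e + width k v * ewt w e"
      using offset unfolding g_def by fastforce
    then have e': "e \<in> edges B (Suc k)" "src B e = v" using src_fibre_level[OF v] by auto
    have "a + width k v * cut_offset e \<in> set (levels (Suc k) (rng B e))"
      unfolding set_levels_Suc[OF rng_edge[OF e'(1)]] using e' a by blast
    then show ?thesis using e e' width_Suc[OF e'(1)] rng_edge[OF e'(1)]
      by (intro bexI[of _ "rng B e"] bexI[of _ "a + width k v * cut_offset e"]) auto
  qed
  ultimately show ?case by blast
qed

end


section \<open>Stable towers and periodic orbits\<close>

text \<open>Since \<open>R\<close> is the graph of a partial map, an orbit is given as a sequence that repeats with period
  \<open>h\<close>. Each of its points then has a successor and a predecessor.\<close>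

definition periodic_within :: "real rel \<Rightarrow> real set \<Rightarrow> real \<Rightarrow> bool" where
  "periodic_within R S x \<longleftrightarrow>
     (\<exists>f h. 0 < h \<and> f 0 = x \<and> (\<forall>j::nat. f (j + h) = f j \<and> (f j, f (Suc j)) \<in> R \<and> f j \<in> S))"

text \<open>For an edge level whose range and source maps are onto, being injective means that the transition
  matrix is a permutation matrix, an identity matrix up to the names of the vertices.\<close>

locale eventually_identity_diagram = ordered_weighted_diagram +
  fixes N :: nat
  assumes inj_rng: "N \<le> k \<Longrightarrow> inj_on (rng B) (edges B (Suc k))"
    and inj_src: "N \<le> k \<Longrightarrow> inj_on (src B) (edges B (Suc k))"
begin

text \<open>The source fibre of \<open>e\<close> is \<open>{e}\<close>, so \<open>e\<close> has weight \<open>1\<close> and nothing is cut; the range fibre is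
  \<open>{e}\<close> as well, so nothing is stacked.\<close>

lemma stable_tower:
  assumes "N \<le> k" "e \<in> edges B (Suc k)"
  shows "levels (Suc k) (rng B e) = levels k (src B e)"
    and "width (Suc k) (rng B e) = width k (src B e)"
proof -
  have s: "src_fibre B (src B e) = {e}"
    using src_fibre_level[OF src_edge[OF assms(2)]] inj_src[OF assms(1)] assms(2)
    by (auto dest: inj_onD)
  have r: "rng_fibre B (rng B e) = {e}"
    using rng_fibre_level[OF rng_edge[OF assms(2)]] inj_rng[OF assms(1)] assms(2)
    by (auto dest: inj_onD)
  have "enumerate_by Os (rng_fibre B (rng B e)) = [e]"
    using stack_order[OF rng_edge[OF assms(2)]] enumerate_by_singleton[of Os e] unfolding r by simp
  moreover have "below Oc {e} e = {}" by (auto simp: below_def)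
  ultimately show "levels (Suc k) (rng B e) = levels k (src B e)" using s by simp
  have "ewt w e = 1" using sum_ewt_src_fibre[OF src_edge[OF assms(2)]] s by simp
  then show "width (Suc k) (rng B e) = width k (src B e)" using width_Suc[OF assms(2)] by simp
qed

text \<open>This path identifies the periodic component whose limiting tower is the tower of \<open>v\<close>.\<close>

lemma infinite_path_through:
  assumes "v \<in> verts B N"
  shows "\<exists>p\<in>infinite_paths B. src B (p N) = v"
proof -
  have "\<exists>f. \<forall>n. (f n \<in> edges B (Suc (N + n)) \<and> (n = 0 \<longrightarrow> src B (f n) = v)) \<and>
      rng B (f n) = src B (f (Suc n))"
  proof (rule dependent_nat_choice)
    show "\<exists>e. e \<in> edges B (Suc (N + 0)) \<and> (0 = (0::nat) \<longrightarrow> src B e = v)"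
      using out_edge_exists[OF assms] by auto
  next
    fix e n assume "e \<in> edges B (Suc (N + n)) \<and> (n = 0 \<longrightarrow> src B e = v)"
    then have "\<exists>e'\<in>edges B (Suc (Suc (N + n))). src B e' = rng B e"
      using out_edge_exists rng_edge by blast
    then show "\<exists>e'. (e' \<in> edges B (Suc (N + Suc n)) \<and> (Suc n = 0 \<longrightarrow> src B e' = v)) \<and>
        rng B e = src B e'" by auto
  qed
  then obtain f where f: "\<And>n. f n \<in> edges B (Suc (N + n))" "src B (f 0) = v"
    "\<And>n. rng B (f n) = src B (f (Suc n))" by auto
  \<comment> \<open>For \<open>N = 0\<close> there is no initial segment and the conditions on \<open>g\<close> are void.\<close>
  obtain g where g: "\<And>i. i < N \<Longrightarrow> g i \<in> edges B (Suc i)"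
    "\<And>i. Suc i < N \<Longrightarrow> rng B (g i) = src B (g (Suc i))"
    "\<And>i. N = Suc i \<Longrightarrow> rng B (g i) = v"
  proof (cases N)
    case 0
    then show ?thesis using that by blast
  next
    case (Suc m)
    then obtain es where es: "es \<in> finite_paths B" "length es = N" "rng B (last es) = v"
      using finite_path_to assms by blast
    have "es \<noteq> []" using es(2) Suc by auto
    then have "last es = es ! m" using es(2) Suc by (simp add: last_conv_nth)
    then show ?thesis using es Suc by (intro that[of "(!) es"]) (auto simp: finite_paths_def)
  qed
  define p where "p i = (if i < N then g i else f (i - N))" for i
  have "p i \<in> edges B (Suc i)" for i
    using g(1)[of i] f(1)[of "i - N"] by (cases "i < N") (simp_all add: p_def)
  moreover have "rng B (p i) = src B (p (Suc i))" for i
  proof -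
    consider "Suc i < N" | "Suc i = N" | "N \<le> i" by linarith
    then show ?thesis
    proof cases
      case 2
      then have "p (Suc i) = f 0" "p i = g i" by (auto simp: p_def)
      then show ?thesis using g(3)[of i] f(2) 2 by simp
    next
      case 3
      then show ?thesis using f(3)[of "i - N"] by (simp add: p_def Suc_diff_le)
    qed (simp add: p_def g(2))
  qed
  ultimately have "p \<in> infinite_paths B" by (simp add: infinite_paths_def)
  moreover have "src B (p N) = v" using f(2) by (simp add: p_def)
  ultimately show ?thesis by blast
qed

text \<open>Beyond level \<open>N\<close> an edge is determined by its range, that is, by the next edge of the path. So
  agreement far out propagates backwards down to level \<open>N\<close>.\<close>

lemma tail_equivalent_paths_agree:
  assumes p: "p \<in> infinite_paths B" and q: "q \<in> tail_class B p" and "N \<le> i"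
  shows "q i = p i"
proof -
  obtain M where M: "\<And>j. M \<le> j \<Longrightarrow> p j = q j"
    using q by (auto simp: tail_class_def eventually_sequentially)
  have pq: "p j \<in> edges B (Suc j)" "q j \<in> edges B (Suc j)" "rng B (p j) = src B (p (Suc j))"
    "rng B (q j) = src B (q (Suc j))" for j
    using p q by (auto simp: tail_class_def infinite_paths_def)
  have "q i = p i" if "i \<le> max M i" using that \<open>N \<le> i\<close>
  proof (induction rule: inc_induct)
    case base
    then show ?case using M[of "max M i"] by simp
  next
    case (step j)
    then have "rng B (q j) = rng B (p j)" using pq by simp
    moreover have "N \<le> j" using step by simp
    ultimately show ?case using inj_onD[OF inj_rng] pq(1,2) by blast
  qed
  then show ?thesis by simp
qed

text \<open>A member of the tail class of \<open>p\<close> is determined by its first \<open>N\<close> edges, for which there are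
  finitely many choices.\<close>

lemma all_paths_periodic:
  assumes p: "p \<in> infinite_paths B"
  shows "in_periodic_component B p"
proof -
  define L where "L = {es. set es \<subseteq> (\<Union>i<N. edges B (Suc i)) \<and> length es = N}"
  have "finite L" unfolding L_def by (intro finite_lists_length_eq) (simp add: finite_edges)
  have "inj_on (\<lambda>q. map q [0..<N]) (tail_class B p)"
  proof (rule inj_onI, rule ext)
    fix q q' i assume q: "q \<in> tail_class B p" "q' \<in> tail_class B p"
      and eq: "map q [0..<N] = map q' [0..<N]"
    show "q i = q' i"
    proof (cases "i < N")
      case True
      then show ?thesis using eq by simp
    next
      case False
      then show ?thesis
        using tail_equivalent_paths_agree[OF p q(1), of i] tail_equivalent_paths_agree[OF p q(2), of i]
        by simp
    qed
  qed
  moreover have "(\<lambda>q. map q [0..<N]) ` tail_class B p \<subseteq> L"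
    unfolding L_def tail_class_def infinite_paths_def by auto (metis lessThan_iff)
  ultimately have "finite (tail_class B p)"
    using \<open>finite L\<close> finite_subset finite_imageD by blast
  then show ?thesis using p by (simp add: in_periodic_component_def)
qed

lemma stable_along_path:
  assumes "p \<in> infinite_paths B" "N \<le> k"
  shows "levels k (src B (p k)) = levels N (src B (p N)) \<and>
    width k (src B (p k)) = width N (src B (p N))"
  using assms(2)
proof (induction rule: dec_induct)
  case (step k)
  have "p k \<in> edges B (Suc k)" "rng B (p k) = src B (p (Suc k))"
    using assms(1) by (auto simp: infinite_paths_def)
  then show ?case using stable_tower[of k "p k"] step by simp
qed simp

text \<open>The limits that define the map on a periodic component are limits of sequences that are constant
  from stage \<open>N\<close> on.\<close>

lemma top_level_returns_to_bottom:
  assumes v: "v \<in> verts B N" and t: "0 < t" "t < width N v"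
  shows "(last (levels N v) + t, hd (levels N v) + t) \<in> T"
proof -
  obtain p where p: "p \<in> infinite_paths B" "src B (p N) = v"
    using infinite_path_through[OF v] by blast
  have lim: "lim (\<lambda>k. F (levels k (src B (p k))) (width k (src B (p k)))) =
      F (levels N v) (width N v)" for F :: "real list \<Rightarrow> real \<Rightarrow> real"
  proof (rule limI, rule tendsto_eventually)
    show "\<forall>\<^sub>F k in sequentially.
        F (levels k (src B (p k))) (width k (src B (p k))) = F (levels N v) (width N v)"
      using stable_along_path[OF p(1)] p(2) unfolding eventually_sequentially by metis
  qed
  have "lim (\<lambda>k. last (levels k (src B (p k)))) = last (levels N v)"
    "lim (\<lambda>k. hd (levels k (src B (p k)))) = hd (levels N v)"
    "lim (\<lambda>k. width k (src B (p k))) = width N v"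
    using lim[of "\<lambda>xs _. last xs"] lim[of "\<lambda>xs _. hd xs"] lim[of "\<lambda>_ x. x"] by blast+
  then have "(last (levels N v) + t, hd (levels N v) + t) \<in> periodic_map B w Ov Oc Os"
    unfolding periodic_map_def Let_def mem_Collect_eq case_prod_conv
    using all_paths_periodic[OF p(1)] t by (intro exI[of _ p]) simp
  then show ?thesis by (simp add: cut_stack_map_def)
qed

lemma level_to_next_level:
  assumes v: "v \<in> verts B N" and t: "0 < t" "t < width N v" and h: "h = length (levels N v)"
  shows "(levels N v ! (i mod h) + t, levels N v ! (Suc i mod h) + t) \<in> T"
proof -
  have "0 < h" using levels_nonempty[OF v] h by simp
  then have lt: "i mod h < h" by simp
  show ?thesis
  proof (cases "Suc (i mod h) = h")
    case True
    then have "levels N v ! (i mod h) = last (levels N v)"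
      using h levels_nonempty[OF v] by (metis diff_Suc_1 last_conv_nth)
    moreover have "levels N v ! (Suc i mod h) = hd (levels N v)"
      using True levels_nonempty[OF v] by (simp add: mod_Suc hd_conv_nth)
    ultimately show ?thesis using top_level_returns_to_bottom[OF v t] by simp
  next
    case False
    then have "Suc (i mod h) < h" "Suc i mod h = Suc (i mod h)" using lt by (auto simp: mod_Suc)
    then have "(levels N v ! (i mod h) + t, levels N v ! (Suc i mod h) + t)
        \<in> stage_map B w Ov Oc Os N"
      unfolding stage_map_def using v t h by (auto intro!: bexI[of _ v] exI[of _ "i mod h"])
    then show ?thesis by (auto simp: cut_stack_map_def)
  qed
qed

text \<open>A point at distance \<open>t\<close> from the left end of its level runs cyclically through the points at
  distance \<open>t\<close> from the left ends of all levels of the tower. To keep this orbit off the finite set \<open>E\<close>,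
  the translates of \<open>E\<close> by differences of levels are excluded too.\<close>

lemma almost_all_points_periodic:
  assumes "finite E"
  shows "\<exists>Z. finite Z \<and> (\<forall>u\<in>verts B 0. \<forall>x\<in>base u - Z.
     periodic_within T ((\<Union>u\<in>verts B 0. base u) - E) x)"
proof -
  obtain Z where Z: "finite Z" "\<And>u x. u \<in> verts B 0 \<Longrightarrow> x \<in> base u - Z \<Longrightarrow>
     \<exists>v\<in>verts B N. \<exists>a\<in>set (levels N v). a < x \<and> x < a + width N v"
    using almost_all_points_in_levels[of N] by blast
  define Z' where "Z' = Z \<union> (\<Union>c\<in>E. \<Union>v\<in>verts B N. \<Union>a\<in>set (levels N v).
     \<Union>b\<in>set (levels N v). {c + (a - b)})"
  have "finite Z'" unfolding Z'_def using Z(1) assms finite_verts by auto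
  moreover have "periodic_within T ((\<Union>u\<in>verts B 0. base u) - E) x"
    if u: "u \<in> verts B 0" "x \<in> base u - Z'" for u x
  proof -
    obtain v a where v: "v \<in> verts B N" and a: "a \<in> set (levels N v)" "a < x" "x < a + width N v"
      using Z(2)[of u x] u by (auto simp: Z'_def)
    define h where "h = length (levels N v)"
    obtain i where i: "i < h" "levels N v ! i = a"
      using a(1) unfolding h_def in_set_conv_nth by blast
    define f where "f j = levels N v ! ((i + j) mod h) + (x - a)" for j
    have level: "levels N v ! (j mod h) \<in> set (levels N v)" for j
    proof -
      have "0 < h" using i(1) by simp
      then have "j mod h < length (levels N v)" by (simp flip: h_def)
      then show ?thesis by (rule nth_mem)
    qed
    have "f 0 = x" using i by (simp add: f_def)
    moreover have "f (j + h) = f j" for j by (simp add: f_def flip: add.assoc)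
    moreover have "(f j, f (Suc j)) \<in> T" for j
      using level_to_next_level[OF v _ _ h_def, of "x - a" "i + j"] a by (simp add: f_def)
    moreover have "f j \<in> (\<Union>u\<in>verts B 0. base u)" for j
    proof -
      obtain u' where "u' \<in> verts B 0"
        "{levels N v ! ((i + j) mod h) <..< levels N v ! ((i + j) mod h) + width N v} \<subseteq> base u'"
        using levels_in_base[OF v level] by blast
      moreover have "f j \<in> {levels N v ! ((i + j) mod h) <..< levels N v ! ((i + j) mod h) + width N v}"
        using a by (simp add: f_def)
      ultimately show ?thesis by blast
    qed
    moreover have "f j \<notin> E" for j
    proof
      assume "f j \<in> E"
      then have "f j + (a - levels N v ! ((i + j) mod h)) \<in> Z'"
        unfolding Z'_def using v a(1) level by (intro UnI2 UN_I) auto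
      then show False using u(2) by (simp add: f_def)
    qed
    ultimately show ?thesis
      unfolding periodic_within_def using i(1) by (intro exI[of _ f] exI[of _ h]) auto
  qed
  ultimately show ?thesis by blast
qed

end


section \<open>Trajectories through glued rectangles\<close>

text \<open>Here \<open>L = 0\<close> is allowed, so that trajectories can cross rectangles of width or height \<open>0\<close>, which
  occur because vertex weights may vanish.\<close>

definition flows_to ::
    "'v rectangles \<Rightarrow> real \<times> real \<Rightarrow> real \<Rightarrow> (real \<times> real) set \<Rightarrow> (real \<times> real) set \<Rightarrow> bool" where
  "flows_to G d L s s' \<longleftrightarrow> (\<exists>\<gamma>. flow_trajectory G d L \<gamma> \<and> \<gamma> 0 = s \<and> \<gamma> L = s')"

lemma surface_point_in_surface: "p \<in> regular_points G \<Longrightarrow> surface_point G p \<in> surface G"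
  by (simp add: surface_point_def surface_def quotientI)

lemma surface_point_eq_if_glued:
  assumes "(p, q) \<in> gluing G" "p \<in> regular_points G" "q \<in> regular_points G"
  shows "surface_point G p = surface_point G q"
proof -
  have "(p, q) \<in> surface_equiv G"
    using assms unfolding surface_equiv_def Let_def by auto
  then show ?thesis
    unfolding surface_point_def by (rule equiv_class_eq[OF equiv_surface_equiv])
qed

lemma flows_to_segment:
  assumes "0 \<le> l" "\<And>\<tau>. 0 \<le> \<tau> \<Longrightarrow> \<tau> \<le> l \<Longrightarrow> p + \<tau> *\<^sub>R d \<in> regular_points G"
  shows "flows_to G d l (surface_point G p) (surface_point G (p + l *\<^sub>R d))"
proof -
  define \<gamma> where "\<gamma> t = surface_point G (p + t *\<^sub>R d)" for t
  have "\<exists>q. \<exists>\<epsilon>>0. \<forall>\<tau>\<in>{0..<\<epsilon>}. q + \<tau> *\<^sub>R d \<in> regular_points G \<and>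
      \<gamma> (t + \<tau>) = surface_point G (q + \<tau> *\<^sub>R d)" if "t \<in> {0..<l}" for t
  proof (intro exI conjI ballI)
    show "0 < l - t" using that by simp
    fix \<tau> assume "\<tau> \<in> {0..<l - t}"
    then show "p + t *\<^sub>R d + \<tau> *\<^sub>R d \<in> regular_points G"
      using assms(2)[of "t + \<tau>"] that by (simp add: scaleR_add_left add.assoc)
    show "\<gamma> (t + \<tau>) = surface_point G (p + t *\<^sub>R d + \<tau> *\<^sub>R d)"
      by (simp add: \<gamma>_def scaleR_add_left add.assoc)
  qed
  moreover have "\<exists>q. \<exists>\<epsilon>>0. \<forall>\<tau>\<in>{0..<\<epsilon>}. q - \<tau> *\<^sub>R d \<in> regular_points G \<and>
      \<gamma> (t - \<tau>) = surface_point G (q - \<tau> *\<^sub>R d)" if "t \<in> {0<..l}" for t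
  proof (intro exI conjI ballI)
    show "0 < t" using that by simp
    fix \<tau> assume "\<tau> \<in> {0..<t}"
    then show "p + t *\<^sub>R d - \<tau> *\<^sub>R d \<in> regular_points G"
      using assms(2)[of "t - \<tau>"] that by (simp add: scaleR_diff_left add_diff_eq)
    show "\<gamma> (t - \<tau>) = surface_point G (p + t *\<^sub>R d - \<tau> *\<^sub>R d)"
      by (simp add: \<gamma>_def scaleR_diff_left add_diff_eq)
  qed
  moreover have "\<gamma> t \<in> surface G" if "t \<in> {0..l}" for t
    using that assms(2) by (simp add: \<gamma>_def surface_point_in_surface)
  ultimately have "flow_trajectory G d l \<gamma>" unfolding flow_trajectory_def by blast
  then show ?thesis unfolding flows_to_def by (intro exI[of _ \<gamma>]) (simp add: \<gamma>_def)
qed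

text \<open>At the junction the forward segment is taken from the second trajectory and the backward segment
  from the first, so the two need to meet in a point of the surface only and may start from different
  representatives of it.\<close>

lemma flows_to_trans:
  assumes "flows_to G d K s s'" "flows_to G d L s' s''" "0 \<le> K" "0 \<le> L"
  shows "flows_to G d (K + L) s s''"
proof -
  obtain \<alpha> where \<alpha>: "flow_trajectory G d K \<alpha>" "\<alpha> 0 = s" "\<alpha> K = s'"
    using assms(1) by (auto simp: flows_to_def)
  obtain \<beta> where \<beta>: "flow_trajectory G d L \<beta>" "\<beta> 0 = s'" "\<beta> L = s''"
    using assms(2) by (auto simp: flows_to_def)
  define \<gamma> where "\<gamma> t = (if t \<le> K then \<alpha> t else \<beta> (t - K))" for t
  have \<gamma>\<alpha>: "\<gamma> t = \<alpha> t" if "t \<le> K" for t using that by (simp add: \<gamma>_def)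
  \<comment> \<open>Both descriptions are valid at the junction \<open>t = K\<close>.\<close>
  have \<gamma>\<beta>: "\<gamma> t = \<beta> (t - K)" if "K \<le> t" for t
    using that \<alpha>(3) \<beta>(2) by (cases "t = K") (auto simp: \<gamma>_def)
  have "\<gamma> t \<in> surface G" if "t \<in> {0..K + L}" for t
  proof (cases "t \<le> K")
    case True
    then show ?thesis using \<alpha>(1) that \<gamma>\<alpha> by (simp add: flow_trajectory_def)
  next
    case False
    then show ?thesis using \<beta>(1) that \<gamma>\<beta>[of t] by (simp add: flow_trajectory_def)
  qed
  moreover have "\<exists>p. \<exists>\<epsilon>>0. \<forall>\<tau>\<in>{0..<\<epsilon>}. p + \<tau> *\<^sub>R d \<in> regular_points G \<and>
      \<gamma> (t + \<tau>) = surface_point G (p + \<tau> *\<^sub>R d)" if t: "t \<in> {0..<K + L}" for t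
  proof (cases "t < K")
    case True
    then obtain p \<epsilon> where "0 < \<epsilon>" "\<forall>\<tau>\<in>{0..<\<epsilon>}. p + \<tau> *\<^sub>R d \<in> regular_points G \<and>
        \<alpha> (t + \<tau>) = surface_point G (p + \<tau> *\<^sub>R d)"
      using \<alpha>(1) t unfolding flow_trajectory_def by (meson atLeastLessThan_iff)
    then show ?thesis using True \<gamma>\<alpha>
      by (intro exI[of _ p] exI[of _ "min \<epsilon> (K - t)"]) auto
  next
    case False
    then have "t - K \<in> {0..<L}" using t by auto
    then obtain p \<epsilon> where "0 < \<epsilon>" "\<forall>\<tau>\<in>{0..<\<epsilon>}. p + \<tau> *\<^sub>R d \<in> regular_points G \<and>
        \<beta> (t - K + \<tau>) = surface_point G (p + \<tau> *\<^sub>R d)"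
      using \<beta>(1) unfolding flow_trajectory_def by meson
    then show ?thesis using False \<gamma>\<beta>
      by (intro exI[of _ p] exI[of _ \<epsilon>]) (auto simp: algebra_simps)
  qed
  moreover have "\<exists>p. \<exists>\<epsilon>>0. \<forall>\<tau>\<in>{0..<\<epsilon>}. p - \<tau> *\<^sub>R d \<in> regular_points G \<and>
      \<gamma> (t - \<tau>) = surface_point G (p - \<tau> *\<^sub>R d)" if t: "t \<in> {0<..K + L}" for t
  proof (cases "t \<le> K")
    case True
    then obtain p \<epsilon> where "0 < \<epsilon>" "\<forall>\<tau>\<in>{0..<\<epsilon>}. p - \<tau> *\<^sub>R d \<in> regular_points G \<and>
        \<alpha> (t - \<tau>) = surface_point G (p - \<tau> *\<^sub>R d)"
      using \<alpha>(1) t unfolding flow_trajectory_def by (meson greaterThanAtMost_iff)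
    then show ?thesis using True \<gamma>\<alpha> by (intro exI[of _ p] exI[of _ \<epsilon>]) auto
  next
    case False
    then have "t - K \<in> {0<..L}" using t by auto
    then obtain p \<epsilon> where "0 < \<epsilon>" "\<forall>\<tau>\<in>{0..<\<epsilon>}. p - \<tau> *\<^sub>R d \<in> regular_points G \<and>
        \<beta> (t - K - \<tau>) = surface_point G (p - \<tau> *\<^sub>R d)"
      using \<beta>(1) unfolding flow_trajectory_def by meson
    moreover have "\<gamma> (t - \<tau>) = \<beta> (t - K - \<tau>)" if "\<tau> < t - K" for \<tau>
      using \<gamma>\<beta>[of "t - \<tau>"] that by (simp add: algebra_simps)
    ultimately show ?thesis using False
      by (intro exI[of _ p] exI[of _ "min \<epsilon> (t - K)"]) auto
  qed
  ultimately have "flow_trajectory G d (K + L) \<gamma>" unfolding flow_trajectory_def by blast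
  then show ?thesis
    unfolding flows_to_def using \<alpha> \<beta> \<gamma>\<alpha>[of 0] \<gamma>\<beta>[of "K + L"] assms(3,4)
    by (intro exI[of _ \<gamma>]) auto
qed

text \<open>Segments of lengths \<open>l j\<close>, each glued to the next, form a closed trajectory when the \<open>h\<close>-th
  segment starts where the first one does. Starting inside the first segment and asking for \<open>0 < l 0\<close>
  makes the total time positive even if all other segments are degenerate.\<close>

lemma closed_chain_returns:
  fixes b :: "nat \<Rightarrow> real \<times> real" and l :: "nat \<Rightarrow> real"
  assumes l: "\<And>j. 0 \<le> l j"
    and reg: "\<And>j \<tau>. 0 \<le> \<tau> \<Longrightarrow> \<tau> \<le> l j \<Longrightarrow> b j + \<tau> *\<^sub>R d \<in> regular_points G"
    and glue: "\<And>j. surface_point G (b j + l j *\<^sub>R d) = surface_point G (b (Suc j))"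
    and h: "0 < h" "b h = b 0"
    and c: "0 \<le> c" "c \<le> l 0" "0 < l 0"
  shows "returns_to_itself G d (surface_point G (b 0 + c *\<^sub>R d))"
proof -
  have seg: "flows_to G d (l j) (surface_point G (b j)) (surface_point G (b (Suc j)))" for j
    using flows_to_segment[of "l j" "b j" d G] l reg glue[of j] by simp
  have chain: "flows_to G d (\<Sum>j=1..<n. l j) (surface_point G (b 1)) (surface_point G (b n))"
    if "1 \<le> n" for n
    using that
  proof (induction rule: dec_induct)
    case base
    then show ?case using flows_to_segment[of 0 "b 1" d G] reg[of 0 1] l[of 1] by simp
  next
    case (step n)
    then show ?case using flows_to_trans[OF step.IH seg] l
      by (simp add: sum_nonneg)
  qed
  have "flows_to G d (l 0 - c) (surface_point G (b 0 + c *\<^sub>R d))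
      (surface_point G (b 0 + c *\<^sub>R d + (l 0 - c) *\<^sub>R d))"
  proof (rule flows_to_segment)
    fix \<tau> assume "0 \<le> \<tau>" "\<tau> \<le> l 0 - c"
    then show "b 0 + c *\<^sub>R d + \<tau> *\<^sub>R d \<in> regular_points G"
      using reg[of "c + \<tau>" 0] c by (simp add: scaleR_add_left add.assoc)
  qed (use c in simp)
  moreover have "b 0 + c *\<^sub>R d + (l 0 - c) *\<^sub>R d = b 0 + l 0 *\<^sub>R d"
    by (simp add: scaleR_diff_left)
  ultimately have start: "flows_to G d (l 0 - c) (surface_point G (b 0 + c *\<^sub>R d))
      (surface_point G (b 1))"
    using glue[of 0] by simp
  have "flows_to G d c (surface_point G (b h)) (surface_point G (b 0 + c *\<^sub>R d))"
    using flows_to_segment[of c "b 0" d G] reg[of _ 0] c h(2) by simp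
  from flows_to_trans[OF chain this]
  have "flows_to G d ((\<Sum>j=1..<h. l j) + c) (surface_point G (b 1))
      (surface_point G (b 0 + c *\<^sub>R d))"
    using h(1) l c by (simp add: sum_nonneg)
  from flows_to_trans[OF start this]
  have "flows_to G d (l 0 - c + ((\<Sum>j=1..<h. l j) + c)) (surface_point G (b 0 + c *\<^sub>R d))
      (surface_point G (b 0 + c *\<^sub>R d))"
    using l c by (simp add: sum_nonneg)
  moreover have "0 < l 0 - c + ((\<Sum>j=1..<h. l j) + c)"
    using l c by (simp add: sum_nonneg add_pos_nonneg)
  ultimately show ?thesis unfolding returns_to_itself_def flows_to_def by blast
qed

text \<open>The orbit avoids the abscissae of all corners, so no point over it lies on a vertical edge of a
  rectangle. It is periodic, so the up map and its inverse are defined at each of its points. Hence no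
  point over the orbit is singular, and the leaf can be followed through all the rectangles.\<close>

lemma vertical_return:
  assumes nonneg: "\<And>u. u \<in> idx G \<Longrightarrow> yb G u \<le> yt G u"
    and v: "v \<in> idx G" "xl G v < x" "x < xr G v" "yb G v < y" "y < yt G v"
    and orbit: "periodic_within (up_map G)
      ((\<Union>u\<in>idx G. {xl G u<..<xr G u}) - (\<Union>u\<in>idx G. {xl G u, xr G u})) x"
  shows "returns_to_itself G vertical_direction (surface_point G (x, y))"
proof -
  obtain f :: "nat \<Rightarrow> real" and h where h: "0 < h" "f 0 = x" "\<And>j. f (j + h) = f j"
    and step: "\<And>j. (f j, f (Suc j)) \<in> up_map G"
    and f_in: "\<And>j. \<exists>u\<in>idx G. xl G u < f j \<and> f j < xr G u"
    and f_off: "\<And>j u. u \<in> idx G \<Longrightarrow> f j \<noteq> xl G u \<and> f j \<noteq> xr G u"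
    using orbit unfolding periodic_within_def by fastforce
  have range: "f j \<in> Range (up_map G)" for j
    using step[of "j + h - 1"] h(1) h(3)[of j] by (auto intro!: RangeI[of "f (j + h - 1)"])
  \<comment> \<open>\<open>U z\<close> is a rectangle over \<open>z\<close>. It depends on \<open>z\<close> only, so the chain closes up after \<open>h\<close> steps, and
    it is the given rectangle \<open>v\<close> at the start.\<close>
  define U where "U z = (if z = x then v else SOME u. u \<in> idx G \<and> xl G u < z \<and> z < xr G u)" for z
  have U: "U (f j) \<in> idx G \<and> xl G (U (f j)) < f j \<and> f j < xr G (U (f j))" for j
  proof (cases "f j = x")
    case False
    then show ?thesis
      using someI_ex[of "\<lambda>u. u \<in> idx G \<and> xl G u < f j \<and> f j < xr G u"] f_in[of j]
      by (auto simp: U_def)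
  qed (use v in \<open>simp add: U_def\<close>)
  have reg: "(f j, s) \<in> regular_points G" if "yb G (U (f j)) \<le> s" "s \<le> yt G (U (f j))" for j s
  proof -
    have "(f j, s) \<in> rect G (U (f j))" using U[of j] that by (simp add: rect_def)
    moreover have "(f j, s) \<notin> singular_points G"
      using range[of j] step[of j] f_off[of _ j]
      by (auto simp: singular_points_def right_edge_def left_edge_def)
    ultimately show ?thesis using U[of j] by (auto simp: regular_points_def)
  qed
  define b where "b j = (f j, yb G (U (f j)))" for j
  define l where "l j = yt G (U (f j)) - yb G (U (f j))" for j
  have "surface_point G (b j + l j *\<^sub>R vertical_direction) = surface_point G (b (Suc j))" for j
  proof (rule surface_point_eq_if_glued)
    have "b j + l j *\<^sub>R vertical_direction = (f j, yt G (U (f j)))" by (simp add: b_def l_def)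
    moreover have "(f j, yt G (U (f j))) \<in> top_edge G (U (f j))"
      "b (Suc j) \<in> bottom_edge G (U (f (Suc j)))"
      using U[of j] U[of "Suc j"] by (auto simp: b_def top_edge_def bottom_edge_def)
    ultimately show "(b j + l j *\<^sub>R vertical_direction, b (Suc j)) \<in> gluing G"
      unfolding gluing_def using U[of j] U[of "Suc j"] step[of j]
      by (intro UnI1) (fastforce simp: b_def)
  qed (use reg U nonneg in \<open>simp_all add: b_def l_def\<close>)
  moreover have "b h = b 0" using h(3)[of 0] by (simp add: b_def)
  moreover have "l j \<ge> 0" for j using U nonneg by (simp add: l_def)
  moreover have "b j + \<tau> *\<^sub>R vertical_direction \<in> regular_points G" if "0 \<le> \<tau>" "\<tau> \<le> l j" for j \<tau>
    using that reg by (simp add: b_def l_def)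
  moreover have "U (f 0) = v" using h(2) by (simp add: U_def)
  ultimately have "returns_to_itself G vertical_direction
      (surface_point G (b 0 + (y - yb G v) *\<^sub>R vertical_direction))"
    using h(1) v by (intro closed_chain_returns[where l = l and h = h]) (auto simp: l_def)
  then show ?thesis using h(2) \<open>U (f 0) = v\<close> by (simp add: b_def)
qed

text \<open>This is the argument of \<open>vertical_return\<close> with the coordinates exchanged.\<close>

lemma horizontal_return:
  assumes nonneg: "\<And>u. u \<in> idx G \<Longrightarrow> xl G u \<le> xr G u"
    and v: "v \<in> idx G" "xl G v < x" "x < xr G v" "yb G v < y" "y < yt G v"
    and orbit: "periodic_within (right_map G)
      ((\<Union>u\<in>idx G. {yb G u<..<yt G u}) - (\<Union>u\<in>idx G. {yb G u, yt G u})) y"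
  shows "returns_to_itself G horizontal_direction (surface_point G (x, y))"
proof -
  obtain f :: "nat \<Rightarrow> real" and h where h: "0 < h" "f 0 = y" "\<And>j. f (j + h) = f j"
    and step: "\<And>j. (f j, f (Suc j)) \<in> right_map G"
    and f_in: "\<And>j. \<exists>u\<in>idx G. yb G u < f j \<and> f j < yt G u"
    and f_off: "\<And>j u. u \<in> idx G \<Longrightarrow> f j \<noteq> yb G u \<and> f j \<noteq> yt G u"
    using orbit unfolding periodic_within_def by fastforce
  have range: "f j \<in> Range (right_map G)" for j
    using step[of "j + h - 1"] h(1) h(3)[of j] by (auto intro!: RangeI[of "f (j + h - 1)"])
  define U where "U z = (if z = y then v else SOME u. u \<in> idx G \<and> yb G u < z \<and> z < yt G u)" for z
  have U: "U (f j) \<in> idx G \<and> yb G (U (f j)) < f j \<and> f j < yt G (U (f j))" for j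
  proof (cases "f j = y")
    case False
    then show ?thesis
      using someI_ex[of "\<lambda>u. u \<in> idx G \<and> yb G u < f j \<and> f j < yt G u"] f_in[of j]
      by (auto simp: U_def)
  qed (use v in \<open>simp add: U_def\<close>)
  have reg: "(s, f j) \<in> regular_points G" if "xl G (U (f j)) \<le> s" "s \<le> xr G (U (f j))" for j s
  proof -
    have "(s, f j) \<in> rect G (U (f j))" using U[of j] that by (simp add: rect_def)
    moreover have "(s, f j) \<notin> singular_points G"
      using range[of j] step[of j] f_off[of _ j]
      by (auto simp: singular_points_def top_edge_def bottom_edge_def)
    ultimately show ?thesis using U[of j] by (auto simp: regular_points_def)
  qed
  define b where "b j = (xl G (U (f j)), f j)" for j
  define l where "l j = xr G (U (f j)) - xl G (U (f j))" for j
  have "surface_point G (b j + l j *\<^sub>R horizontal_direction) = surface_point G (b (Suc j))" for j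
  proof (rule surface_point_eq_if_glued)
    have "b j + l j *\<^sub>R horizontal_direction = (xr G (U (f j)), f j)" by (simp add: b_def l_def)
    moreover have "(xr G (U (f j)), f j) \<in> right_edge G (U (f j))"
      "b (Suc j) \<in> left_edge G (U (f (Suc j)))"
      using U[of j] U[of "Suc j"] by (auto simp: b_def right_edge_def left_edge_def)
    ultimately show "(b j + l j *\<^sub>R horizontal_direction, b (Suc j)) \<in> gluing G"
      unfolding gluing_def using U[of j] U[of "Suc j"] step[of j]
      by (intro UnI2) (fastforce simp: b_def)
  qed (use reg U nonneg in \<open>simp_all add: b_def l_def\<close>)
  moreover have "b h = b 0" using h(3)[of 0] by (simp add: b_def)
  moreover have "l j \<ge> 0" for j using U nonneg by (simp add: l_def)
  moreover have "b j + \<tau> *\<^sub>R horizontal_direction \<in> regular_points G" if "0 \<le> \<tau>" "\<tau> \<le> l j" for j \<tau>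
    using that reg by (simp add: b_def l_def)
  moreover have "U (f 0) = v" using h(2) by (simp add: U_def)
  ultimately have "returns_to_itself G horizontal_direction
      (surface_point G (b 0 + (x - xl G v) *\<^sub>R horizontal_direction))"
    using h(1) v by (intro closed_chain_returns[where l = l and h = h]) (auto simp: l_def)
  then show ?thesis using h(2) \<open>U (f 0) = v\<close> by (simp add: b_def)
qed

text \<open>Finitely many vertical and horizontal lines form a null set.\<close>

lemma completely_periodic_off_lines:
  assumes "finite A" "finite C"
    and ret: "\<And>v x y. v \<in> idx G \<Longrightarrow> (x, y) \<in> rect G v \<Longrightarrow> x \<notin> A \<Longrightarrow> y \<notin> C \<Longrightarrow>
      returns_to_itself G d (surface_point G (x, y))"
  shows "completely_periodic G d"
proof -
  let ?N = "(\<Union>a\<in>A. {p. p \<bullet> (1, 0) = a}) \<union> (\<Union>c\<in>C. {p :: real \<times> real. p \<bullet> (0, 1) = c})"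
  have "negligible {p :: real \<times> real. p \<bullet> (1, 0) = a}" for a
    by (rule negligible_standard_hyperplane) (simp add: Basis_prod_def)
  moreover have "negligible {p :: real \<times> real. p \<bullet> (0, 1) = c}" for c
    by (rule negligible_standard_hyperplane) (simp add: Basis_prod_def)
  ultimately have "negligible ?N"
    using assms(1,2) by (intro negligible_Un negligible_Union) blast+
  then have null: "?N \<in> null_sets lebesgue" by (simp add: negligible_iff_null_sets)
  show ?thesis
    unfolding completely_periodic_def
  proof (rule AE_I'[OF null], rule subsetI)
    fix p assume "p \<in> {p \<in> space lebesgue.
      \<not> (p \<in> regular_points G \<longrightarrow> returns_to_itself G d (surface_point G p))}"
    then have p: "p \<in> regular_points G" "\<not> returns_to_itself G d (surface_point G p)" by auto
    then obtain v where "v \<in> idx G" "(fst p, snd p) \<in> rect G v"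
      by (auto simp: regular_points_def)
    then have "fst p \<in> A \<or> snd p \<in> C" using ret[of v "fst p" "snd p"] p(2) by auto
    then show "p \<in> ?N" by (auto simp: inner_prod_def)
  qed
qed


section \<open>Diagrams with identity matrices far out\<close>

text \<open>Both parts of the bi-infinite diagram are eventually identity diagrams in the sense above, with the
  roles of cutting and stacking exchanged between them.\<close>

theorem eventually_identity_completely_periodic:
  assumes D: "bi_bratteli_diagram D"
    and inj: "\<And>k. int N < \<bar>k\<bar> \<Longrightarrow> inj_on (brng D) (bedges D k) \<and> inj_on (bsrc D) (bedges D k)"
    and W: "weighted D wp wm" and Q: "fully_ordered D Q"
  shows "completely_periodic (rectangles_of D wp wm Q) vertical_direction"
    and "completely_periodic (rectangles_of D wp wm Q) horizontal_direction"
proof -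
  have orders: "\<forall>k. \<forall>v\<in>bverts D k.
      totally_orders (ord_r Q) {e \<in> (\<Union>l\<in>{l. l \<noteq> 0}. bedges D l). brng D e = v} \<and>
      totally_orders (ord_s Q) {e \<in> (\<Union>l\<in>{l. l \<noteq> 0}. bedges D l). bsrc D e = v}"
    using Q unfolding fully_ordered_def by (rule conjunct1)
  note r = orders[rule_format, THEN conjunct1] and s = orders[rule_format, THEN conjunct2]
  have edges_pos: "all_edges (positive_part D) \<subseteq> (\<Union>l\<in>{l. l \<noteq> 0}. bedges D l)"
  proof
    fix e assume "e \<in> all_edges (positive_part D)"
    then obtain k where "1 \<le> k" "e \<in> bedges D (int k)"
      by (auto simp: all_edges_def positive_part_def)
    then show "e \<in> (\<Union>l\<in>{l. l \<noteq> 0}. bedges D l)" by (intro UN_I[of "int k"]) auto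
  qed
  have edges_neg: "all_edges (negative_part D) \<subseteq> (\<Union>l\<in>{l. l \<noteq> 0}. bedges D l)"
  proof
    fix e assume "e \<in> all_edges (negative_part D)"
    then obtain k where "1 \<le> k" "e \<in> bedges D (- int k)"
      by (auto simp: all_edges_def negative_part_def)
    then show "e \<in> (\<Union>l\<in>{l. l \<noteq> 0}. bedges D l)" by (intro UN_I[of "- int k"]) auto
  qed
  interpret P: eventually_identity_diagram "positive_part D" wp "ord_v Q" "ord_s Q" "ord_r Q" N
  proof
    show "bratteli_diagram (positive_part D)" by (rule bratteli_diagram_positive_part[OF D])
    show "weight_function (positive_part D) wp"
      using W by (simp add: weighted_def probability_weight_function_def)
    fix v k assume "v \<in> verts (positive_part D) k"
    then have v: "v \<in> bverts D (int k)" by (simp add: positive_part_def)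
    show "totally_orders (ord_s Q) (src_fibre (positive_part D) v)"
      by (rule totally_orders_subset[OF s[OF v]])
        (use edges_pos in \<open>auto simp: src_fibre_def positive_part_def\<close>)
    show "totally_orders (ord_r Q) (rng_fibre (positive_part D) v)"
      by (rule totally_orders_subset[OF r[OF v]])
        (use edges_pos in \<open>auto simp: rng_fibre_def positive_part_def\<close>)
  next
    fix k assume "N \<le> k"
    then show "inj_on (rng (positive_part D)) (edges (positive_part D) (Suc k))"
      and "inj_on (src (positive_part D)) (edges (positive_part D) (Suc k))"
      using inj[of "int (Suc k)"] by (auto simp: positive_part_def)
  qed
  interpret M: eventually_identity_diagram "negative_part D" wm "ord_v Q" "ord_r Q" "ord_s Q" N
  proof
    show "bratteli_diagram (negative_part D)" by (rule bratteli_diagram_negative_part[OF D])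
    show "weight_function (negative_part D) wm" using W by (simp add: weighted_def)
    fix v k assume "v \<in> verts (negative_part D) k"
    then have v: "v \<in> bverts D (- int k)" by (simp add: negative_part_def)
    show "totally_orders (ord_r Q) (src_fibre (negative_part D) v)"
      by (rule totally_orders_subset[OF r[OF v]])
        (use edges_neg in \<open>auto simp: src_fibre_def negative_part_def\<close>)
    show "totally_orders (ord_s Q) (rng_fibre (negative_part D) v)"
      by (rule totally_orders_subset[OF s[OF v]])
        (use edges_neg in \<open>auto simp: rng_fibre_def negative_part_def\<close>)
  next
    fix k assume "N \<le> k"
    then show "inj_on (rng (negative_part D)) (edges (negative_part D) (Suc k))"
      and "inj_on (src (negative_part D)) (edges (negative_part D) (Suc k))"
      using inj[of "- int (Suc k)"] by (auto simp: negative_part_def)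
  qed
  define G where "G = rectangles_of D wp wm Q"
  have V: "verts (positive_part D) 0 = idx G" "verts (negative_part D) 0 = idx G"
    by (simp_all add: G_def rectangles_of_def positive_part_def negative_part_def)
  have maps: "up_map G = P.T" "right_map G = M.T"
    by (simp_all add: G_def rectangles_of_def)
  have base: "{xl G u<..<xr G u} = P.base u" "{yb G u<..<yt G u} = M.base u" for u
    by (simp_all add: G_def rectangles_of_def)
  have fin: "finite (idx G)" using P.finite_verts[of 0] V by simp
  have "0 \<le> vwt wp u" "0 \<le> vwt wm u" if "u \<in> idx G" for u
    using that V P.width_nonneg[of u 0] M.width_nonneg[of u 0]
    by (simp_all add: vertex_weight_def)
  then have nonneg: "xl G u \<le> xr G u" "yb G u \<le> yt G u" if "u \<in> idx G" for u
    using that by (simp_all add: G_def rectangles_of_def)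
  \<comment> \<open>Off these coordinates a point of a rectangle is interior to it; in particular rectangles of width
    or height \<open>0\<close> are discarded.\<close>
  define X where "X = (\<Union>u\<in>idx G. {xl G u, xr G u})"
  define Y where "Y = (\<Union>u\<in>idx G. {yb G u, yt G u})"
  have finXY: "finite X" "finite Y" using fin by (simp_all add: X_def Y_def)
  have interior: "xl G v < x \<and> x < xr G v \<and> yb G v < y \<and> y < yt G v"
    if "v \<in> idx G" "(x, y) \<in> rect G v" "x \<notin> X" "y \<notin> Y" for v x y
  proof -
    have "x \<noteq> xl G v" "x \<noteq> xr G v" "y \<noteq> yb G v" "y \<noteq> yt G v"
      using that(1,3,4) unfolding X_def Y_def by blast+
    then show ?thesis using that(2) by (simp add: rect_def)
  qed
  obtain Z where Z: "finite Z" "\<And>u x. u \<in> idx G \<Longrightarrow> x \<in> {xl G u<..<xr G u} - Z \<Longrightarrow>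
      periodic_within (up_map G) ((\<Union>u\<in>idx G. {xl G u<..<xr G u}) - X) x"
    using P.almost_all_points_periodic[OF finXY(1)] unfolding V maps base by blast
  obtain Z' where Z': "finite Z'" "\<And>u y. u \<in> idx G \<Longrightarrow> y \<in> {yb G u<..<yt G u} - Z' \<Longrightarrow>
      periodic_within (right_map G) ((\<Union>u\<in>idx G. {yb G u<..<yt G u}) - Y) y"
    using M.almost_all_points_periodic[OF finXY(2)] unfolding V maps base by blast
  have "completely_periodic G vertical_direction"
  proof (rule completely_periodic_off_lines[where A = "X \<union> Z" and C = Y])
    fix v x y assume *: "v \<in> idx G" "(x, y) \<in> rect G v" "x \<notin> X \<union> Z" "y \<notin> Y"
    then have int: "xl G v < x" "x < xr G v" "yb G v < y" "y < yt G v"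
      using interior[of v x y] by auto
    show "returns_to_itself G vertical_direction (surface_point G (x, y))"
      using vertical_return[OF nonneg(2) *(1) int] Z(2)[OF *(1), of x] int *(3)
      unfolding X_def by simp
  qed (use finXY Z in auto)
  then show "completely_periodic (rectangles_of D wp wm Q) vertical_direction"
    by (simp add: G_def)
  have "completely_periodic G horizontal_direction"
  proof (rule completely_periodic_off_lines[where A = X and C = "Y \<union> Z'"])
    fix v x y assume *: "v \<in> idx G" "(x, y) \<in> rect G v" "x \<notin> X" "y \<notin> Y \<union> Z'"
    then have int: "xl G v < x" "x < xr G v" "yb G v < y" "y < yt G v"
      using interior[of v x y] by auto
    show "returns_to_itself G horizontal_direction (surface_point G (x, y))"
      using horizontal_return[OF nonneg(1) *(1) int] Z'(2)[OF *(1), of y] int *(4)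
      unfolding Y_def by simp
  qed (use finXY Z' in auto)
  then show "completely_periodic (rectangles_of D wp wm Q) horizontal_direction"
    by (simp add: G_def)
qed

definition truncate_by_identity :: "nat \<Rightarrow> (int \<Rightarrow> nat mat) \<Rightarrow> int \<Rightarrow> nat mat" where
  "truncate_by_identity n F k =
     (if k > int n then 1\<^sub>m (dim_row (F (int n)))
      else if k < - int n then 1\<^sub>m (dim_col (F (- int n)))
      else F k)"

lemma truncate_in_beth:
  assumes F: "F \<in> beth" and n: "0 < n"
  shows "truncate_by_identity n F \<in> beth"
proof -
  let ?G = "truncate_by_identity n F"
  have pos: "0 < dim_row (F k)" "0 < dim_col (F k)" if "k \<noteq> 0" for k
    using F that by (auto simp: beth_def)
  have rows: "\<forall>i<dim_row (F k). \<exists>j<dim_col (F k). F k $$ (i, j) \<noteq> 0"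
    and cols: "\<forall>j<dim_col (F k). \<exists>i<dim_row (F k). F k $$ (i, j) \<noteq> 0" if "k \<noteq> 0" for k
    using F that by (auto simp: beth_def)
  have comp: "dim_col (F (k + 1)) = dim_row (F k)" if "k > 0" for k
    using F that by (auto simp: beth_def)
  have comp0: "dim_col (F 1) = dim_row (F (- 1))"
    using F by (auto simp: beth_def)
  have compn: "dim_col (F k) = dim_row (F (k - 1))" if "k < 0" for k
    using F that by (auto simp: beth_def)
  have "?G \<in> extensional {k. k \<noteq> 0}"
    using F n by (auto simp: beth_def truncate_by_identity_def extensional_def)
  moreover have "0 < dim_row (?G k) \<and> 0 < dim_col (?G k) \<and>
      (\<forall>i<dim_row (?G k). \<exists>j<dim_col (?G k). ?G k $$ (i, j) \<noteq> 0) \<and>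
      (\<forall>j<dim_col (?G k). \<exists>i<dim_row (?G k). ?G k $$ (i, j) \<noteq> 0)" if "k \<noteq> 0" for k
    using rows[OF that] cols[OF that] pos[OF that] pos[of "int n"] pos[of "- int n"] n
    unfolding truncate_by_identity_def by auto
  moreover have "dim_col (?G (k + 1)) = dim_row (?G k)" if "k > 0" for k
  proof -
    consider "k < int n" | "k = int n" | "int n < k" by linarith
    then show ?thesis using comp[OF that] that by cases (auto simp: truncate_by_identity_def)
  qed
  moreover have "dim_col (?G 1) = dim_row (?G (- 1))"
    using comp0 n by (auto simp: truncate_by_identity_def)
  moreover have "dim_col (?G k) = dim_row (?G (k - 1))" if "k < 0" for k
  proof -
    consider "k < - int n" | "k = - int n" | "- int n < k" by linarith
    then show ?thesis using compn[OF that] that by cases (auto simp: truncate_by_identity_def)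
  qed
  ultimately show ?thesis unfolding beth_def by simp
qed

lemma truncate_in_periodic_diagrams:
  assumes F: "F \<in> beth" and n: "0 < n"
  shows "truncate_by_identity n F \<in> periodic_diagrams"
proof -
  let ?D = "diagram_of (truncate_by_identity n F)"
  have G: "truncate_by_identity n F \<in> beth" by (rule truncate_in_beth[OF assms])
  have inj: "inj_on (brng ?D) (bedges ?D k) \<and> inj_on (bsrc ?D) (bedges ?D k)"
    if k: "int n < \<bar>k\<bar>" for k
  proof -
    have "\<exists>m. truncate_by_identity n F k = 1\<^sub>m m"
      using k unfolding truncate_by_identity_def by (cases "k > int n") auto
    then obtain m where m: "truncate_by_identity n F k = 1\<^sub>m m" by blast
    have edges: "bedges ?D k \<subseteq> {(k, i, i, 0) | i. True}"
    proof
      fix e assume "e \<in> bedges ?D k"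
      then obtain i j l where "e = (k, i, j, l)" "i < m" "j < m" "l < (1\<^sub>m m :: nat mat) $$ (i, j)"
        by (auto simp: diagram_of_def m)
      then show "e \<in> {(k, i, i, 0) | i. True}" by (cases "i = j") auto
    qed
    have "inj_on (brng ?D) {(k, i, i, 0) | i. True}" "inj_on (bsrc ?D) {(k, i, i, 0) | i. True}"
      by (auto simp: inj_on_def diagram_of_def)
    then show ?thesis by (intro conjI inj_on_subset[OF _ edges])
  qed
  show ?thesis
    unfolding periodic_diagrams_def
    using G eventually_identity_completely_periodic[OF bi_bratteli_diagram_diagram_of[OF G] inj]
    by blast
qed

text \<open>The cylinders around \<open>F\<close> are closed under finite intersections, so the generating sets already
  form a neighbourhood base at \<open>F\<close>.\<close>

lemma openin_beth_contains_cylinder: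
  assumes "openin beth_topology U" "F \<in> U"
  shows "\<exists>K. finite K \<and> 0 \<notin> K \<and> cylinder K F \<subseteq> U"
proof -
  have "generate_topology_on {cylinder K F | K F. finite K \<and> 0 \<notin> K} U"
    using assms(1) by (simp add: beth_topology_def openin_topology_generated_by_iff)
  then show ?thesis using assms(2)
  proof (induction rule: generate_topology_on.induct)
    case (Int a b)
    then obtain K L where "finite K" "0 \<notin> K" "cylinder K F \<subseteq> a" "finite L" "0 \<notin> L"
      "cylinder L F \<subseteq> b" by blast
    then show ?case by (intro exI[of _ "K \<union> L"]) (auto simp: cylinder_def)
  next
    case (UN \<U>)
    then obtain a where a: "a \<in> \<U>" "F \<in> a" by blast
    with UN.IH obtain K where "finite K \<and> 0 \<notin> K \<and> cylinder K F \<subseteq> a" by blast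
    then show ?case using a(1) by (intro exI[of _ K]) auto
  next
    case (Basis s)
    then obtain K F' where K: "s = cylinder K F'" "finite K" "0 \<notin> K" by blast
    then have "cylinder K F = s" using Basis.prems by (auto simp: cylinder_def)
    then show ?case using K by blast
  qed simp
qed

theorem proposition2:
  shows "beth_topology closure_of periodic_diagrams = beth"
proof (intro equalityI subsetI)
  fix F assume "F \<in> beth_topology closure_of periodic_diagrams"
  then show "F \<in> beth"
    using closure_of_subset_topspace[of beth_topology] by (auto simp: topspace_beth_topology)
next
  fix F assume F: "F \<in> beth"
  have "\<exists>G. G \<in> periodic_diagrams \<and> G \<in> U" if U: "F \<in> U" "openin beth_topology U" for U
  proof -
    obtain K where K: "finite K" "cylinder K F \<subseteq> U"
      using openin_beth_contains_cylinder[OF U(2,1)] by blast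
    obtain n :: nat where n: "\<And>k. k \<in> K \<Longrightarrow> nat \<bar>k\<bar> < n" "0 < n"
      using finite_nat_set_iff_bounded[of "insert 0 ((\<lambda>k. nat \<bar>k\<bar>) ` K)"] K(1) by auto
    have "truncate_by_identity n F k = F k" if "k \<in> K" for k
      using n(1)[OF that] by (auto simp: truncate_by_identity_def)
    then have "truncate_by_identity n F \<in> cylinder K F"
      using truncate_in_beth[OF F n(2)] by (simp add: cylinder_def)
    then show ?thesis using truncate_in_periodic_diagrams[OF F n(2)] K(2) by blast
  qed
  then show "F \<in> beth_topology closure_of periodic_diagrams"
    using F by (auto simp: in_closure_of topspace_beth_topology)
qed

end
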